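(* Let $i\in\mathbb{N}=\{1,2,\ldots\}$ and let $y=\frac{\sqrt{i^2+4}-i}{2}=[i,i,i,\ldots]$. For every nonnegative real number $\nu$, $$\dim_H\{x\in[0,1)\colon\nu(x)=\nu\}=s\Big(\frac{\nu}{1+\nu},\tau(i)\Big).$$
   Context: $\dim_H$ denotes Hausdorff dimension. $T\colon[0,1)\to[0,1)$ is the Gauss map: $T(0)=0$ and $T(x)=1/x \pmod 1$ for $x\in(0,1)$. An irrational $x\in[0,1)$ has the continued fraction expansion $x=[a_1(x),a_2(x),\ldots]$ with $a_n(x)=\lfloor 1/T^{n-1}(x)\rfloor$. $I_n(y)$ is the basic interval of order $n$ containing $y$, i.e. the set of $x\in[0,1)$ whose first $n$ partial quotients are those of $y$ (here all equal to $i$), and $|\cdot|$ is its length. For $x\in[0,1)$, the asymptotic approximation exponent (with respect to $y$) is $$\nu(x)=\sup\{\nu\ge0\colon |T^n(x)-y|<|I_n(y)|^{\nu}\text{ for infinitely many }n\in\mathbb{N}\}.$$ For positive integers $a_1,\ldots,a_n$, $q_n(a_1,\ldots,a_n)$ is the denominator of the convergent $[a_1,\ldots,a_n]$, given by $q_{-1}=0$, $q_0=1$, $q_k=a_kq_{k-1}+q_{k-2}$. Put $\tau(i)=\frac{i+\sqrt{i^2+4}}{2}$. For $0<\alpha<1$, $s(\alpha,\tau(i))$ is the limit (known to exist) $$s(\alpha,\tau(i))=\lim_{n\to\infty}\inf\Big\{\rho\ge0\colon \sum_{a_1,\ldots,a_n\in\mathbb{N}}\Big(\frac{1}{\tau(i)^{\frac{n\alpha}{1-\alpha}}\,q_n(a_1,\ldots,a_n)}\Big)^{2\rho}\le1\Big\},$$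 and one sets $s(0,\tau(i))=1$, $s(1,\tau(i))=\frac12$. *)

theory Defs
  imports "HOL-Analysis.Analysis"
begin

section \<open>Hausdorff measure and dimension\<close>

text \<open>
  The summand \<open>(diam U)\<^sup>s\<close> with the usual conventions: the empty set contributes 0, and
  \<open>0\<^sup>0 = 1\<close> for nonempty \<open>U\<close> (in HOL, \<open>0 powr 0 = 0\<close>).
\<close>
definition hausdorff_gauge :: "real \<Rightarrow> 'a::metric_space set \<Rightarrow> ennreal" where
  "hausdorff_gauge s U =
     (if U = {} then 0 else if s = 0 then 1 else ennreal (diameter U powr s))"

text \<open>Boundedness is required because \<^const>\<open>diameter\<close> is only meaningful on bounded sets.\<close>
definition hausdorff_pre_measure :: "real \<Rightarrow> real \<Rightarrow> 'a::metric_space set \<Rightarrow> ennreal" where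
  "hausdorff_pre_measure s \<delta> E =
     Inf {(\<Sum>k. hausdorff_gauge s (U k)) | U :: nat \<Rightarrow> 'a set.
            E \<subseteq> (\<Union>k. U k) \<and> (\<forall>k. bounded (U k) \<and> diameter (U k) \<le> \<delta>)}"

definition hausdorff_measure :: "real \<Rightarrow> 'a::metric_space set \<Rightarrow> ennreal" where
  "hausdorff_measure s E = (SUP \<delta>\<in>{0<..}. hausdorff_pre_measure s \<delta> E)"

definition hausdorff_dim :: "'a::metric_space set \<Rightarrow> ereal" where
  "hausdorff_dim E = Inf {ereal s | s. 0 \<le> s \<and> hausdorff_measure s E = 0}"


section \<open>Continued fractions\<close>

definition gauss_map :: "real \<Rightarrow> real" where
  "gauss_map x = (if x = 0 then 0 else frac (1 / x))"

text \<open>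
  Meaningful for \<open>n \<ge> 1\<close>. If \<open>x\<close> is rational and its expansion has fewer than \<open>n\<close> terms, then
  the value is 0 (since \<open>1 / 0 = 0\<close>), which is never a genuine partial quotient.
\<close>
definition partial_quotient :: "nat \<Rightarrow> real \<Rightarrow> int" where
  "partial_quotient n x = \<lfloor>1 / (gauss_map ^^ (n - 1)) x\<rfloor>"

definition basic_interval :: "nat \<Rightarrow> real \<Rightarrow> real set" where
  "basic_interval n y =
     {x \<in> {0..<1}. \<forall>k\<in>{1..n}. partial_quotient k x = partial_quotient k y}"

text \<open>
  The asymptotic approximation exponent of \<open>x\<close> with respect to \<open>y\<close>. It can be infinite
  (for instance if some iterate of \<open>x\<close> is a fixed point \<open>y\<close>), hence the extended reals.
\<close>
definition asymp_exponent :: "real \<Rightarrow> real \<Rightarrow> ereal" where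
  "asymp_exponent y x =
     Sup {ereal v | v. 0 \<le> v \<and>
       infinite {n :: nat. \<bar>(gauss_map ^^ n) x - y\<bar> < measure lborel (basic_interval n y) powr v}}"

text \<open>
  \<open>cf_denom a n\<close> is \<open>q\<^sub>n(a\<^sub>1,\<dots>,a\<^sub>n)\<close>; the value \<open>a 0\<close> is not used. The case of index 1 is the
  general recursion with \<open>q\<^sub>0 = 1\<close> and \<open>q\<^sub>-\<^sub>1 = 0\<close>.
\<close>
fun cf_denom :: "(nat \<Rightarrow> nat) \<Rightarrow> nat \<Rightarrow> nat" where
  "cf_denom a 0 = 1"
| "cf_denom a (Suc 0) = a 1"
| "cf_denom a (Suc (Suc k)) = a (Suc (Suc k)) * cf_denom a (Suc k) + cf_denom a k"


section \<open>The dimension number\<close>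

definition tau :: "nat \<Rightarrow> real" where
  "tau i = (real i + sqrt ((real i)\<^sup>2 + 4)) / 2"

text \<open>
  The tuples \<open>(a\<^sub>1,\<dots>,a\<^sub>n)\<close> of positive integers are the extensional functions on \<open>{1..n}\<close>. The
  series is taken in the extended nonnegative reals, so that a divergent series has value
  \<open>\<infinity>\<close> and does not satisfy the inequality.
\<close>
definition pre_dim_number :: "real \<Rightarrow> real \<Rightarrow> nat \<Rightarrow> real" where
  "pre_dim_number \<alpha> t n =
     Inf {\<rho> :: real. 0 \<le> \<rho> \<and>
       (\<Sum>\<^sub>\<infinity>a\<in>PiE {1..n} (\<lambda>_. {1..}).
          ennreal ((1 / (t powr (real n * \<alpha> / (1 - \<alpha>)) * real (cf_denom a n))) powr (2 * \<rho>))) \<le> 1}"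

definition dim_number :: "real \<Rightarrow> real \<Rightarrow> real" where
  "dim_number \<alpha> t =
     (if \<alpha> = 0 then 1 else if \<alpha> = 1 then 1 / 2 else lim (\<lambda>n. pre_dim_number \<alpha> t n))"


section \<open>The quadratic irrational with constant partial quotients\<close>

definition const_cf :: "nat \<Rightarrow> real" where
  "const_cf i = (sqrt ((real i)\<^sup>2 + 4) - real i) / 2"

lemma const_cf_bounds:
  assumes "i \<ge> 1"
  shows "0 < const_cf i" "const_cf i < 1"
proof -
  have "real i < sqrt ((real i)\<^sup>2 + 4)"
    by (rule real_less_rsqrt) simp
  then show "0 < const_cf i" by (simp add: const_cf_def)
  have "sqrt ((real i)\<^sup>2 + 4) < real i + 2"
    by (rule real_less_lsqrt) (use assms in \<open>auto simp: power2_eq_square algebra_simps\<close>)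
  then show "const_cf i < 1" by (simp add: const_cf_def)
qed

lemma inverse_const_cf:
  assumes "i \<ge> 1"
  shows "1 / const_cf i = real i + const_cf i"
proof -
  have "const_cf i * (real i + const_cf i) = ((sqrt ((real i)\<^sup>2 + 4))\<^sup>2 - (real i)\<^sup>2) / 4"
    unfolding const_cf_def by (simp add: power2_eq_square field_simps del: real_sqrt_mult_self)
  also have "\<dots> = 1" by simp
  finally show ?thesis using const_cf_bounds[OF assms] by (simp add: field_simps)
qed

lemma gauss_map_const_cf:
  assumes "i \<ge> 1"
  shows "gauss_map (const_cf i) = const_cf i"
proof -
  have "frac (real i + const_cf i) = const_cf i"
    using const_cf_bounds[OF assms] by (simp add: frac_unique_iff)
  then show ?thesis
    using const_cf_bounds[OF assms] by (simp add: gauss_map_def inverse_const_cf[OF assms])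
qed

lemma partial_quotient_const_cf:
  assumes "i \<ge> 1"
  shows "partial_quotient n (const_cf i) = int i"
proof -
  have "(gauss_map ^^ k) (const_cf i) = const_cf i" for k
    by (induction k) (simp_all add: gauss_map_const_cf[OF assms])
  then have "partial_quotient n (const_cf i) = \<lfloor>real i + const_cf i\<rfloor>"
    by (simp add: partial_quotient_def inverse_const_cf[OF assms])
  also have "\<dots> = int i"
    using const_cf_bounds[OF assms] by (simp add: floor_eq_iff)
  finally show ?thesis .
qed

end

theory Submission
  imports Defs
begin

text \<open>
  Writing \<open>\<tau>\<close> for \<open>tau i\<close>, the condition \<open>\<bar>T\<^sup>n x - y\<bar> < \<bar>I\<^sub>n(y)\<bar>\<^sup>v\<close> says that \<open>T\<^sup>n x\<close> starts with a run of about
  \<open>v n\<close> partial quotients \<open>i\<close>, so that \<open>\<nu>(x)\<close> is the upper limit of the run length at \<open>n\<close> divided by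
  \<open>n\<close>. Since denominators are multiplicative up to a factor 2, the dimension number is the exponent at
  which \<open>W\<^sub>n(\<rho>) = \<Sum> (\<tau>\<^sup>n\<^sup>\<nu> q\<^sub>n(a\<^sub>1,\<dots>,a\<^sub>n))\<^sup>-\<^sup>2\<^sup>\<rho>\<close> passes from exponential growth to exponential decay.
  Above it, the preimages of small neighbourhoods of \<open>y\<close> under \<open>T\<^sup>n\<close> give efficient covers. Below it,
  some \<open>W\<^sub>N(t)\<close> is so large that finitely many words of length \<open>N\<close>, each followed by \<open>i + 1\<close> to stop
  runs, suffice: one concatenates such words freely and inserts runs of \<open>i\<close> of relative length \<open>\<nu>\<close> at
  very sparse places. The resulting Cantor set lies in the level set, and it is coded by points of
  \<open>[0,1)\<close> in such a way that the coding has a \<open>t\<close>-Hoelder inverse. For \<open>\<nu> = 0\<close> the same construction works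
  because the lengths of the basic intervals of order \<open>n\<close> add up to 1.
\<close>

subsection \<open>Inverse branches of the Gauss map and their denominators\<close>

primrec cf_map :: "nat list \<Rightarrow> real \<Rightarrow> real" where
  "cf_map [] z = z"
| "cf_map (a # w) z = 1 / (real a + cf_map w z)"

text \<open>\<open>cf_den w z\<close> is \<open>q\<^sub>n + z q\<^sub>n\<^sub>-\<^sub>1\<close>, the inverse square root of the derivative of \<open>cf_map w\<close> at \<open>z\<close> up to
  sign. The product form makes the distortion identity \<open>abs_cf_map_diff\<close> a trivial induction.\<close>

primrec cf_den :: "nat list \<Rightarrow> real \<Rightarrow> real" where
  "cf_den [] z = 1"
| "cf_den (a # w) z = (real a + cf_map w z) * cf_den w z"

lemma cf_map_append: "cf_map (v @ w) z = cf_map v (cf_map w z)"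
  by (induction v) auto

lemma cf_den_append: "cf_den (v @ w) z = cf_den v (cf_map w z) * cf_den w z"
  by (induction v) (auto simp: cf_map_append)

lemma cf_map_bounds:
  assumes "0 \<notin> set w" "0 \<le> z" "z \<le> 1"
  shows "0 \<le> cf_map w z" "cf_map w z \<le> 1"
proof -
  have "0 \<le> cf_map w z \<and> cf_map w z \<le> 1" using assms
  proof (induction w)
    case (Cons a w)
    then have "real a + cf_map w z \<ge> 1" by (cases a) auto
    then show ?case by auto
  qed auto
  then show "0 \<le> cf_map w z" "cf_map w z \<le> 1" by auto
qed

lemma cf_map_Cons_denom_ge_1:
  assumes "0 \<notin> set (a # w)" "0 \<le> z" "z \<le> 1"
  shows "real a + cf_map w z \<ge> 1"
  using cf_map_bounds[of w z] assms by (cases a) auto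

lemma cf_den_ge_1:
  assumes "0 \<notin> set w" "0 \<le> z" "z \<le> 1"
  shows "cf_den w z \<ge> 1"
  using assms
proof (induction w)
  case (Cons a w)
  then show ?case
    using mult_mono[of 1 "real a + cf_map w z" 1 "cf_den w z"] cf_map_Cons_denom_ge_1[OF Cons.prems]
    by auto
qed auto

lemma abs_cf_map_diff:
  assumes "0 \<notin> set w" "0 \<le> z" "z \<le> 1" "0 \<le> z'" "z' \<le> 1"
  shows "\<bar>cf_map w z - cf_map w z'\<bar> = \<bar>z - z'\<bar> / (cf_den w z * cf_den w z')"
  using assms
proof (induction w)
  case (Cons a w)
  define u u' where "u = real a + cf_map w z" and "u' = real a + cf_map w z'"
  have "u \<ge> 1" "u' \<ge> 1"
    using cf_map_Cons_denom_ge_1 Cons.prems unfolding u_def u'_def by auto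
  then have "\<bar>1 / u - 1 / u'\<bar> = \<bar>u' - u\<bar> / (u * u')"
    by (simp add: divide_simps abs_mult)
  also have "\<bar>u' - u\<bar> = \<bar>z - z'\<bar> / (cf_den w z * cf_den w z')"
    using Cons by (simp add: u_def u'_def abs_minus_commute)
  finally show ?case by (simp add: u_def u'_def mult_ac)
qed auto

lemma cf_map_inj:
  assumes "0 \<notin> set w" "0 \<le> z" "z \<le> 1" "0 \<le> z'" "z' \<le> 1" "cf_map w z = cf_map w z'"
  shows "z = z'"
proof -
  have "\<bar>z - z'\<bar> / (cf_den w z * cf_den w z') = 0"
    using abs_cf_map_diff[OF assms(1-5)] assms(6) by simp
  moreover have "cf_den w z \<noteq> 0" "cf_den w z' \<noteq> 0"
    using cf_den_ge_1[OF assms(1-3)] cf_den_ge_1[OF assms(1,4,5)] by linarith+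
  ultimately show ?thesis by simp
qed

lemma cf_den_affine:
  assumes "0 \<notin> set w"
  shows "\<exists>R. 0 \<le> R \<and> R \<le> cf_den w 0 \<and> (\<forall>z. 0 \<le> z \<and> z \<le> 1 \<longrightarrow> cf_den w z = cf_den w 0 + z * R)"
  using assms
proof (induction w rule: rev_induct)
  case (snoc a w)
  have "0 \<notin> set w" using snoc.prems by simp
  from snoc.IH[OF this] obtain R where R: "0 \<le> R" "R \<le> cf_den w 0"
    "\<And>z. 0 \<le> z \<Longrightarrow> z \<le> 1 \<Longrightarrow> cf_den w z = cf_den w 0 + z * R" by blast
  have a: "real a \<ge> 1" using snoc.prems by (cases a) auto
  have *: "cf_den (w @ [a]) z = real a * cf_den w 0 + R + z * cf_den w 0" if "0 \<le> z" for z
    using R(3)[of "1 / (real a + z)"] that a by (simp add: cf_den_append field_simps)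
  have Q: "cf_den w 0 \<ge> 1" using snoc.prems by (intro cf_den_ge_1) auto
  have e: "cf_den (w @ [a]) 0 = real a * cf_den w 0 + R" using *[of 0] by simp
  show ?case
  proof (intro exI[of _ "cf_den w 0"] conjI allI impI)
    show "cf_den w 0 \<le> cf_den (w @ [a]) 0"
      unfolding e using a Q R(1) mult_right_mono[of 1 "real a" "cf_den w 0"] by linarith
    show "0 \<le> cf_den w 0" using Q by linarith
    fix z :: real assume "0 \<le> z \<and> z \<le> 1"
    then show "cf_den (w @ [a]) z = cf_den (w @ [a]) 0 + z * cf_den w 0"
      using *[of z] e by linarith
  qed
qed (rule exI[of _ 0], simp)

lemma cf_den_bounds:
  assumes "0 \<notin> set w" "0 \<le> z" "z \<le> 1"
  shows "cf_den w 0 \<le> cf_den w z" "cf_den w z \<le> 2 * cf_den w 0"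
proof -
  obtain R where R: "0 \<le> R" "R \<le> cf_den w 0" "cf_den w z = cf_den w 0 + z * R"
    using cf_den_affine[OF assms(1)] assms by blast
  have "z * R \<le> 1 * R" using R assms by (intro mult_right_mono) auto
  then show "cf_den w 0 \<le> cf_den w z" "cf_den w z \<le> 2 * cf_den w 0"
    using R assms by auto
qed

lemma cf_den_append_bounds:
  assumes "0 \<notin> set v" "0 \<notin> set w"
  shows "cf_den v 0 * cf_den w 0 \<le> cf_den (v @ w) 0"
    and "cf_den (v @ w) 0 \<le> 2 * cf_den v 0 * cf_den w 0"
proof -
  have b: "0 \<le> cf_map w 0" "cf_map w 0 \<le> 1" using cf_map_bounds[OF assms(2)] by auto
  have "cf_den w 0 \<ge> 1" using cf_den_ge_1[OF assms(2)] by auto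
  then show "cf_den v 0 * cf_den w 0 \<le> cf_den (v @ w) 0"
    and "cf_den (v @ w) 0 \<le> 2 * cf_den v 0 * cf_den w 0"
    using cf_den_bounds[OF assms(1) b] by (auto simp: cf_den_append intro!: mult_right_mono)
qed

lemma cf_den_le_append:
  assumes "0 \<notin> set v" "0 \<notin> set w"
  shows "cf_den v 0 \<le> cf_den (v @ w) 0"
proof -
  have "1 \<le> cf_den w 0" "1 \<le> cf_den v 0" using cf_den_ge_1 assms by auto
  then have "cf_den v 0 * 1 \<le> cf_den v 0 * cf_den w 0" by (intro mult_left_mono) auto
  then show ?thesis using cf_den_append_bounds(1)[OF assms] by linarith
qed

lemma abs_cf_map_diff_le:
  assumes "0 \<notin> set w" "0 \<le> z" "z \<le> 1" "0 \<le> z'" "z' \<le> 1"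
  shows "\<bar>cf_map w z - cf_map w z'\<bar> \<le> \<bar>z - z'\<bar> / (cf_den w 0)\<^sup>2"
proof -
  have d: "1 \<le> cf_den w 0" "cf_den w 0 \<le> cf_den w z" "cf_den w 0 \<le> cf_den w z'"
    using cf_den_ge_1[of w 0] cf_den_bounds[of w] assms by auto
  then have "cf_den w 0 * cf_den w 0 \<le> cf_den w z * cf_den w z'"
    by (intro mult_mono) auto
  then show ?thesis
    unfolding abs_cf_map_diff[OF assms] power2_eq_square using d
    by (intro divide_left_mono mult_pos_pos) auto
qed

lemma abs_cf_map_diff_ge:
  assumes "0 \<notin> set w" "0 \<le> z" "z \<le> 1" "0 \<le> z'" "z' \<le> 1"
  shows "\<bar>z - z'\<bar> / (4 * (cf_den w 0)\<^sup>2) \<le> \<bar>cf_map w z - cf_map w z'\<bar>"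
proof -
  have d: "1 \<le> cf_den w z" "1 \<le> cf_den w z'" "cf_den w z \<le> 2 * cf_den w 0" "cf_den w z' \<le> 2 * cf_den w 0"
    using cf_den_ge_1[of w] cf_den_bounds[of w] assms by auto
  then have "cf_den w z * cf_den w z' \<le> (2 * cf_den w 0) * (2 * cf_den w 0)"
    by (intro mult_mono) auto
  then have "cf_den w z * cf_den w z' \<le> 4 * (cf_den w 0)\<^sup>2"
    by (simp add: power2_eq_square)
  then show ?thesis
    unfolding abs_cf_map_diff[OF assms] using d
    by (intro divide_left_mono mult_pos_pos) auto
qed

lemma cf_den_eq_cf_denom:
  assumes "0 \<notin> set (map a [1..<Suc n])"
  shows "cf_den (map a [1..<Suc n]) 0 = real (cf_denom a n)"
proof -
  have step: "cf_den (map a [1..<Suc (Suc n)]) z = real (cf_denom a (Suc n)) + z * real (cf_denom a n)"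
    if "0 \<notin> set (map a [1..<Suc (Suc n)])" "0 \<le> z" for z n
    using that
  proof (induction n arbitrary: z)
    case (Suc n)
    define b where "b = a (Suc (Suc n))"
    have b: "b \<noteq> 0" using Suc.prems(1) by (auto simp: b_def)
    have "[1..<Suc (Suc (Suc n))] = [1..<Suc (Suc n)] @ [Suc (Suc n)]" by simp
    then have "cf_den (map a [1..<Suc (Suc (Suc n))]) z
        = cf_den (map a [1..<Suc (Suc n)]) (1 / (real b + z)) * (real b + z)"
      by (simp only: map_append cf_den_append) (simp add: b_def)
    also have "cf_den (map a [1..<Suc (Suc n)]) (1 / (real b + z))
        = real (cf_denom a (Suc n)) + 1 / (real b + z) * real (cf_denom a n)"
      using Suc.prems by (intro Suc.IH) auto
    also have "\<dots> * (real b + z) = real (cf_denom a (Suc (Suc n))) + z * real (cf_denom a (Suc n))"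
      using b Suc.prems by (simp add: field_simps b_def)
    finally show ?case .
  qed simp
  show ?thesis
  proof (cases n)
    case (Suc m)
    then show ?thesis using step[of m 0] assms by simp
  qed simp
qed

lemma two_power_le_cf_den:
  assumes "0 \<notin> set w" "length w = 2 * n"
  shows "2 ^ n \<le> cf_den w 0"
  using assms
proof (induction n arbitrary: w)
  case (Suc n)
  then obtain a b v where w: "w = [a, b] @ v" "length v = 2 * n"
    by (auto simp: length_Suc_conv)
  have ab: "real a \<ge> 1" "real b \<ge> 1" using Suc.prems w by (cases a; cases b; auto)+
  have "cf_den [a, b] 0 = real a * real b + 1" using ab by (simp add: field_simps)
  also have "\<dots> \<ge> 2" using mult_mono[of 1 "real a" 1 "real b"] ab by simp
  finally have "2 * 2 ^ n \<le> cf_den [a, b] 0 * cf_den v 0"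
    using Suc w by (intro mult_mono) auto
  also have "\<dots> \<le> cf_den w 0"
    using Suc.prems w by (auto intro!: cf_den_append_bounds(1)[of "[a, b]" v, simplified])
  finally show ?case by simp
qed auto

lemma open_interval_image_inverse_add:
  fixes a l h :: real
  assumes "0 < a" "0 \<le> l" "l < h"
  shows "(\<lambda>z. 1 / (a + z)) ` {l<..<h} = {1 / (a + h)<..<1 / (a + l)}"
proof (intro equalityI subsetI)
  fix x assume "x \<in> (\<lambda>z. 1 / (a + z)) ` {l<..<h}"
  then show "x \<in> {1 / (a + h)<..<1 / (a + l)}" using assms
    by (auto intro!: divide_strict_left_mono mult_pos_pos)
next
  fix x assume x: "x \<in> {1 / (a + h)<..<1 / (a + l)}"
  have x0: "x > 0" using x assms by (auto intro: less_trans[of 0 "1 / (a + h)"])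
  have "1 / x - a \<in> {l<..<h}" using x x0 assms by (simp add: field_simps)
  moreover have "x = 1 / (a + (1 / x - a))" using x0 by simp
  ultimately show "x \<in> (\<lambda>z. 1 / (a + z)) ` {l<..<h}" by blast
qed

lemma cf_map_image_unit_interval:
  assumes "0 \<notin> set w"
  shows "cf_map w ` {0<..<1} = {min (cf_map w 0) (cf_map w 1)<..<max (cf_map w 0) (cf_map w 1)}"
  using assms
proof (induction w)
  case (Cons a w)
  let ?l = "min (cf_map w 0) (cf_map w 1)" and ?h = "max (cf_map w 0) (cf_map w 1)"
  have a: "real a > 0" using Cons.prems by (cases a) auto
  have pos: "0 \<le> cf_map w 0" "0 \<le> cf_map w 1" and ne: "cf_map w 0 \<noteq> cf_map w 1"
    using cf_map_bounds[of w] cf_map_inj[of w 0 1] Cons.prems by auto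
  have b: "0 \<le> ?l" "?l < ?h"
    using pos ne by linarith+
  have "cf_map (a # w) ` {0<..<1} = (\<lambda>z. 1 / (real a + z)) ` (cf_map w ` {0<..<1})"
    by (simp add: image_image)
  also have "\<dots> = {1 / (real a + ?h)<..<1 / (real a + ?l)}"
    using Cons open_interval_image_inverse_add[OF a b] by simp
  also have "\<dots> = {min (cf_map (a # w) 0) (cf_map (a # w) 1)<..<max (cf_map (a # w) 0) (cf_map (a # w) 1)}"
  proof (cases "cf_map w 0 \<le> cf_map w 1")
    case True
    then have "cf_map (a # w) 1 \<le> cf_map (a # w) 0"
      using a pos by (auto intro!: divide_left_mono mult_pos_pos add_pos_nonneg)
    with True show ?thesis by (simp only: max_absorb1 max_absorb2 min_absorb1 min_absorb2 cf_map.simps)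
  next
    case False
    then have *: "cf_map w 1 \<le> cf_map w 0" by simp
    then have "cf_map (a # w) 0 \<le> cf_map (a # w) 1"
      using a pos by (auto intro!: divide_left_mono mult_pos_pos add_pos_nonneg)
    with * show ?thesis by (simp only: max_absorb1 max_absorb2 min_absorb1 min_absorb2 cf_map.simps)
  qed
  finally show ?case .
qed auto

lemma measure_cf_map_image:
  assumes "0 \<notin> set w"
  shows "measure lborel (cf_map w ` {0<..<1}) = 1 / (cf_den w 0 * cf_den w 1)"
proof -
  have "measure lborel (cf_map w ` {0<..<1}) = \<bar>cf_map w 0 - cf_map w 1\<bar>"
    unfolding cf_map_image_unit_interval[OF assms]
    by (cases "cf_map w 0 \<le> cf_map w 1") auto
  then show ?thesis using abs_cf_map_diff[OF assms, of 0 1] by simp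
qed

subsection \<open>Sums over words of partial quotients\<close>

lemma sum_le_nn_integral_count_space:
  assumes "finite F" "F \<subseteq> A"
  shows "sum f F \<le> (\<integral>\<^sup>+x. f x \<partial>count_space A)"
proof -
  have "sum f F = (\<integral>\<^sup>+x. f x * indicator F x \<partial>count_space A)"
    using assms by (subst nn_integral_count_space'[of F]) (auto simp: indicator_def)
  also have "\<dots> \<le> (\<integral>\<^sup>+x. f x \<partial>count_space A)"
    by (intro nn_integral_mono) (auto simp: indicator_def)
  finally show ?thesis .
qed

lemma infsum_eq_nn_integral_count_space:
  fixes f :: "'a \<Rightarrow> ennreal"
  assumes "countable A"
  shows "infsum f A = (\<integral>\<^sup>+x. f x \<partial>count_space A)"
proof (cases "finite A")
  case True
  then show ?thesis by (simp add: nn_integral_count_space_finite)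
next
  case False
  have S: "infsum f A = (SUP F\<in>{F. finite F \<and> F \<subseteq> A}. sum f F)"
    by (rule nonneg_infsum_complete) auto
  show ?thesis
  proof (rule antisym)
    show "infsum f A \<le> (\<integral>\<^sup>+x. f x \<partial>count_space A)"
      unfolding S by (intro SUP_least sum_le_nn_integral_count_space) auto
    have bij: "bij_betw (from_nat_into A) UNIV A"
      using assms False by (rule bij_betw_from_nat_into)
    have "(\<integral>\<^sup>+x. f x \<partial>count_space A) = (\<integral>\<^sup>+n. f (from_nat_into A n) \<partial>count_space UNIV)"
      by (rule nn_integral_bij_count_space[OF bij, symmetric])
    also have "\<dots> = (SUP N. \<Sum>n<N. f (from_nat_into A n))"
      by (simp add: nn_integral_count_space_nat suminf_eq_SUP)
    also have "\<dots> \<le> infsum f A"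
    proof (rule SUP_least)
      fix N
      have "(\<Sum>n<N. f (from_nat_into A n)) = sum f (from_nat_into A ` {..<N})"
        using bij by (subst sum.reindex) (auto simp: bij_betw_def intro: inj_on_subset)
      also have "\<dots> \<le> infsum f A"
        unfolding S using bij by (intro SUP_upper) (auto simp: bij_betw_def)
      finally show "(\<Sum>n<N. f (from_nat_into A n)) \<le> infsum f A" .
    qed
    finally show "(\<integral>\<^sup>+x. f x \<partial>count_space A) \<le> infsum f A" .
  qed
qed

lemma nn_integral_count_space_Times:
  fixes f :: "'a \<Rightarrow> 'b \<Rightarrow> ennreal"
  shows "(\<integral>\<^sup>+p. f (fst p) (snd p) \<partial>count_space (A \<times> B))
    = (\<integral>\<^sup>+x. \<integral>\<^sup>+y. f x y \<partial>count_space B \<partial>count_space A)"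
proof -
  have "(\<integral>\<^sup>+p. f (fst p) (snd p) \<partial>count_space (A \<times> B))
      = (\<integral>\<^sup>+p. f (fst p) (snd p) * indicator (A \<times> B) p \<partial>count_space UNIV)"
    by (simp add: nn_integral_count_space_indicator)
  also have "\<dots> = (\<integral>\<^sup>+x. \<integral>\<^sup>+y. f x y * indicator (A \<times> B) (x, y) \<partial>count_space UNIV \<partial>count_space UNIV)"
    by (subst nn_integral_fst_count_space[symmetric]) simp
  also have "\<dots> = (\<integral>\<^sup>+x. (\<integral>\<^sup>+y. f x y \<partial>count_space B) * indicator A x \<partial>count_space UNIV)"
    by (intro nn_integral_cong)
       (auto simp: nn_integral_count_space_indicator indicator_def intro!: nn_integral_cong)
  also have "\<dots> = (\<integral>\<^sup>+x. \<integral>\<^sup>+y. f x y \<partial>count_space B \<partial>count_space A)"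
    by (simp add: nn_integral_count_space_indicator)
  finally show ?thesis .
qed

definition cf_words :: "nat \<Rightarrow> nat list set" where
  "cf_words n = {w. length w = n \<and> 0 \<notin> set w}"

lemma cf_words_0: "cf_words 0 = {[]}"
  by (auto simp: cf_words_def)

lemma nn_integral_cf_words_append:
  "(\<integral>\<^sup>+u. f u \<partial>count_space (cf_words (m + n)))
    = (\<integral>\<^sup>+v. \<integral>\<^sup>+w. f (v @ w) \<partial>count_space (cf_words n) \<partial>count_space (cf_words m))"
proof -
  have "bij_betw (\<lambda>p. fst p @ snd p) (cf_words m \<times> cf_words n) (cf_words (m + n))"
    by (rule bij_betw_byWitness[where f' = "\<lambda>u. (take m u, drop m u)"])
       (auto simp: cf_words_def dest: in_set_takeD in_set_dropD)
  from nn_integral_bij_count_space[OF this, of f]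
  show ?thesis by (simp add: nn_integral_count_space_Times[where f = "\<lambda>v w. f (v @ w)"])
qed

lemma nn_integral_cf_words_1:
  "(\<integral>\<^sup>+u. f u \<partial>count_space (cf_words 1)) = (\<Sum>a. f [Suc a])"
proof -
  have "bij_betw (\<lambda>a. [Suc a]) UNIV (cf_words 1)"
    by (rule bij_betw_byWitness[where f' = "\<lambda>u. hd u - 1"])
       (auto simp: cf_words_def length_Suc_conv)
  from nn_integral_bij_count_space[OF this, of f]
  show ?thesis by (simp add: nn_integral_count_space_nat)
qed

text \<open>The summand is the length of the basic interval of \<open>w\<close>; the sum over the last partial quotient
  telescopes.\<close>

lemma nn_integral_cf_words_length:
  "(\<integral>\<^sup>+w. ennreal (1 / (cf_den w 0 * cf_den w 1)) \<partial>count_space (cf_words n)) = 1"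
proof (induction n)
  case 0
  show ?case by (simp add: cf_words_0 nn_integral_count_space_finite)
next
  case (Suc n)
  have step: "(\<Sum>a. ennreal (1 / (cf_den (v @ [Suc a]) 0 * cf_den (v @ [Suc a]) 1)))
      = ennreal (1 / (cf_den v 0 * cf_den v 1))" if "v \<in> cf_words n" for v
  proof -
    have v: "0 \<notin> set v" using that by (simp add: cf_words_def)
    obtain R where R: "0 \<le> R" "\<And>z. 0 \<le> z \<Longrightarrow> z \<le> 1 \<Longrightarrow> cf_den v z = cf_den v 0 + z * R"
      using cf_den_affine[OF v] by blast
    define Q where "Q = cf_den v 0"
    have Q: "Q \<ge> 1" using cf_den_ge_1[OF v] by (simp add: Q_def)
    define h where "h a = 1 / (Q * (real (Suc a) * Q + R))" for a
    have pos: "real (Suc a) * Q + R > 0" for a using Q R(1) by (intro add_pos_nonneg mult_pos_pos) auto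
    have d0: "cf_den (v @ [Suc a]) 0 = real (Suc a) * Q + R" for a
      using R(2)[of "1 / real (Suc a)"] by (simp add: cf_den_append Q_def field_simps)
    have d1: "cf_den (v @ [Suc a]) 1 = real (Suc (Suc a)) * Q + R" for a
      using R(2)[of "1 / (real (Suc a) + 1)"] by (simp add: cf_den_append Q_def field_simps)
    have eq: "1 / (cf_den (v @ [Suc a]) 0 * cf_den (v @ [Suc a]) 1) = h a - h (Suc a)" for a
    proof -
      define u where "u = real (Suc a) * Q + R"
      have u: "u > 0" using pos unfolding u_def .
      have u': "real (Suc (Suc a)) * Q + R = u + Q" by (simp add: u_def algebra_simps)
      have "1 / (u * (u + Q)) = 1 / (Q * u) - 1 / (Q * (u + Q))"
      proof -
        have "u \<noteq> 0" "Q \<noteq> 0" "u + Q \<noteq> 0" using u Q by auto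
        then show ?thesis by (simp add: divide_simps)
      qed
      then show ?thesis unfolding d0 d1 h_def u' u_def[symmetric] .
    qed
    have "h \<longlonglongrightarrow> 0"
    proof (rule tendsto_sandwich[OF _ _ tendsto_const LIMSEQ_inverse_real_of_nat])
      show "\<forall>\<^sub>F a in sequentially. 0 \<le> h a"
        using Q pos[THEN less_imp_le] by (auto simp: h_def simp del: of_nat_Suc intro!: always_eventually)
      have "real (Suc a) \<le> Q * (real (Suc a) * Q + R)" for a
      proof -
        have "1 * (real (Suc a) * 1 + 0) \<le> Q * (real (Suc a) * Q + R)"
          using Q R(1) by (intro mult_mono add_mono) auto
        then show ?thesis by simp
      qed
      then show "\<forall>\<^sub>F a in sequentially. h a \<le> inverse (real (Suc a))"
        by (intro always_eventually allI) (simp add: h_def inverse_eq_divide frac_le del: of_nat_Suc)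
    qed
    then have "(\<lambda>a. h a - h (Suc a)) sums (h 0 - 0)" by (rule telescope_sums')
    moreover have "h 0 = 1 / (cf_den v 0 * cf_den v 1)" using R(2)[of 1] by (simp add: h_def Q_def)
    ultimately have s: "(\<lambda>a. 1 / (cf_den (v @ [Suc a]) 0 * cf_den (v @ [Suc a]) 1))
        sums (1 / (cf_den v 0 * cf_den v 1))" by (simp add: eq)
    show ?thesis
      by (rule suminf_ennreal_eq[OF _ s])
         (use d0 d1 pos[THEN less_imp_le] in \<open>simp del: of_nat_Suc\<close>)
  qed
  show ?case
    unfolding Suc_eq_plus1 nn_integral_cf_words_append nn_integral_cf_words_1
    unfolding Suc.IH[symmetric] by (rule nn_integral_cong) (simp add: step)
qed

text \<open>For \<open>b = t powr \<nu>\<close> with \<open>\<nu> = \<alpha> / (1 - \<alpha>)\<close>, \<open>cf_sum b \<rho> n\<close> is the series in \<^const>\<open>pre_dim_number\<close>.\<close>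

definition cf_weight :: "real \<Rightarrow> nat list \<Rightarrow> real" where
  "cf_weight b w = b ^ length w * cf_den w 0"

definition cf_sum :: "real \<Rightarrow> real \<Rightarrow> nat \<Rightarrow> ennreal" where
  "cf_sum b \<rho> n = (\<integral>\<^sup>+w. ennreal (cf_weight b w powr (-2 * \<rho>)) \<partial>count_space (cf_words n))"

lemma cf_weight_ge:
  assumes "1 \<le> b" "0 \<notin> set w"
  shows "b ^ length w \<le> cf_weight b w" "1 \<le> cf_weight b w"
proof -
  have "b ^ length w * 1 \<le> b ^ length w * cf_den w 0" "1 \<le> b ^ length w"
    using assms cf_den_ge_1[of w 0] by (auto intro!: mult_left_mono)
  then show "b ^ length w \<le> cf_weight b w" "1 \<le> cf_weight b w"
    unfolding cf_weight_def by linarith+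
qed

lemma cf_weight_append_bounds:
  assumes "1 \<le> b" "0 \<notin> set v" "0 \<notin> set w"
  shows "cf_weight b v * cf_weight b w \<le> cf_weight b (v @ w)"
    and "cf_weight b (v @ w) \<le> 2 * (cf_weight b v * cf_weight b w)"
proof -
  have "b ^ length (v @ w) * (cf_den v 0 * cf_den w 0) \<le> b ^ length (v @ w) * cf_den (v @ w) 0"
    using assms cf_den_append_bounds by (intro mult_left_mono) auto
  then show "cf_weight b v * cf_weight b w \<le> cf_weight b (v @ w)"
    by (simp add: cf_weight_def power_add mult_ac)
  have "b ^ length (v @ w) * cf_den (v @ w) 0 \<le> b ^ length (v @ w) * (2 * cf_den v 0 * cf_den w 0)"
    using assms cf_den_append_bounds by (intro mult_left_mono) auto
  then show "cf_weight b (v @ w) \<le> 2 * (cf_weight b v * cf_weight b w)"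
    by (simp add: cf_weight_def power_add mult_ac)
qed

lemma powr_antimono_base:
  fixes x y r :: real
  assumes "0 < x" "x \<le> y" "r \<ge> 0"
  shows "y powr (-2 * r) \<le> x powr (-2 * r)"
  using assms powr_mono2'[of "-2 * r" x y] by simp

lemma cf_sum_add_le:
  assumes "1 \<le> b" "0 \<le> \<rho>"
  shows "cf_sum b \<rho> (m + n) \<le> cf_sum b \<rho> m * cf_sum b \<rho> n"
proof -
  have "cf_weight b (v @ w) powr (-2 * \<rho>) \<le> cf_weight b v powr (-2 * \<rho>) * cf_weight b w powr (-2 * \<rho>)"
    if "v \<in> cf_words m" "w \<in> cf_words n" for v w
  proof -
    have vw: "0 \<notin> set v" "0 \<notin> set w" using that by (auto simp: cf_words_def)
    note ge = cf_weight_ge(2)[OF assms(1) vw(1)] cf_weight_ge(2)[OF assms(1) vw(2)]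
    then have "0 < cf_weight b v * cf_weight b w" by (intro mult_pos_pos) auto
    from powr_antimono_base[OF this cf_weight_append_bounds(1)[OF assms(1) vw] assms(2)]
    show ?thesis using ge by (simp add: powr_mult)
  qed
  then have "cf_sum b \<rho> (m + n) \<le> (\<integral>\<^sup>+v. \<integral>\<^sup>+w. ennreal (cf_weight b v powr (-2 * \<rho>))
      * ennreal (cf_weight b w powr (-2 * \<rho>)) \<partial>count_space (cf_words n) \<partial>count_space (cf_words m))"
    unfolding cf_sum_def nn_integral_cf_words_append
    by (intro nn_integral_mono) (simp add: ennreal_mult[symmetric])
  also have "\<dots> = cf_sum b \<rho> m * cf_sum b \<rho> n"
    by (simp add: cf_sum_def nn_integral_cmult nn_integral_multc)
  finally show ?thesis .
qed

lemma cf_sum_mult_le: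
  assumes "1 \<le> b" "0 \<le> \<rho>"
  shows "cf_sum b \<rho> m * cf_sum b \<rho> n \<le> ennreal (2 powr (2 * \<rho>)) * cf_sum b \<rho> (m + n)"
proof -
  have le: "cf_weight b v powr (-2 * \<rho>) * cf_weight b w powr (-2 * \<rho>)
      \<le> 2 powr (2 * \<rho>) * cf_weight b (v @ w) powr (-2 * \<rho>)"
    if "v \<in> cf_words m" "w \<in> cf_words n" for v w
  proof -
    have vw: "0 \<notin> set v" "0 \<notin> set w" "0 \<notin> set (v @ w)" using that by (auto simp: cf_words_def)
    note ge = cf_weight_ge(2)[OF assms(1) vw(1)] cf_weight_ge(2)[OF assms(1) vw(2)]
      cf_weight_ge(2)[OF assms(1) vw(3)]
    have "(2 * (cf_weight b v * cf_weight b w)) powr (-2 * \<rho>) \<le> cf_weight b (v @ w) powr (-2 * \<rho>)"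
      using ge by (intro powr_antimono_base cf_weight_append_bounds(2) assms vw) auto
    also have "(2 * (cf_weight b v * cf_weight b w)) powr (-2 * \<rho>)
        = (cf_weight b v powr (-2 * \<rho>) * cf_weight b w powr (-2 * \<rho>)) / 2 powr (2 * \<rho>)"
      using ge by (simp add: powr_mult powr_minus_divide)
    finally show ?thesis by (simp add: field_simps)
  qed
  have "cf_sum b \<rho> m * cf_sum b \<rho> n = (\<integral>\<^sup>+v. \<integral>\<^sup>+w. ennreal (cf_weight b v powr (-2 * \<rho>))
      * ennreal (cf_weight b w powr (-2 * \<rho>)) \<partial>count_space (cf_words n) \<partial>count_space (cf_words m))"
    by (simp add: cf_sum_def nn_integral_cmult nn_integral_multc)
  also have "\<dots> \<le> (\<integral>\<^sup>+v. \<integral>\<^sup>+w. ennreal (2 powr (2 * \<rho>)) * ennreal (cf_weight b (v @ w) powr (-2 * \<rho>))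
      \<partial>count_space (cf_words n) \<partial>count_space (cf_words m))"
    using le by (intro nn_integral_mono) (simp add: ennreal_mult[symmetric])
  also have "\<dots> = ennreal (2 powr (2 * \<rho>)) * cf_sum b \<rho> (m + n)"
    by (simp add: cf_sum_def nn_integral_cf_words_append nn_integral_cmult)
  finally show ?thesis .
qed

lemma cf_sum_shift_le:
  assumes "1 \<le> b" "\<rho> \<le> \<rho>'"
  shows "cf_sum b \<rho>' n \<le> ennreal (b powr (-2 * real n * (\<rho>' - \<rho>))) * cf_sum b \<rho> n"
proof -
  have le: "cf_weight b w powr (-2 * \<rho>') \<le> b powr (-2 * real n * (\<rho>' - \<rho>)) * cf_weight b w powr (-2 * \<rho>)"
    if "w \<in> cf_words n" for w
  proof -
    have w: "0 \<notin> set w" "length w = n" using that by (auto simp: cf_words_def)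
    have "cf_weight b w powr (-2 * \<rho>') = cf_weight b w powr (-2 * (\<rho>' - \<rho>)) * cf_weight b w powr (-2 * \<rho>)"
      by (simp add: powr_add[symmetric] algebra_simps)
    also have "\<dots> \<le> (b ^ n) powr (-2 * (\<rho>' - \<rho>)) * cf_weight b w powr (-2 * \<rho>)"
      using cf_weight_ge[OF assms(1) w(1)] assms w
      by (intro mult_right_mono powr_antimono_base) auto
    also have "(b ^ n) powr (-2 * (\<rho>' - \<rho>)) = b powr (-2 * real n * (\<rho>' - \<rho>))"
      using assms by (simp add: powr_realpow[symmetric] powr_powr algebra_simps)
    finally show ?thesis .
  qed
  then show ?thesis unfolding cf_sum_def
    by (subst nn_integral_cmult[symmetric]) (auto intro!: nn_integral_mono simp: ennreal_mult[symmetric])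
qed

lemma cf_sum_antimono:
  assumes "1 \<le> b" "\<rho> \<le> \<rho>'"
  shows "cf_sum b \<rho>' n \<le> cf_sum b \<rho> n"
proof -
  have "b powr (-2 * real n * (\<rho>' - \<rho>)) \<le> b powr 0"
    using assms by (intro powr_mono) (auto intro: mult_nonpos_nonneg)
  then have "ennreal (b powr (-2 * real n * (\<rho>' - \<rho>))) * cf_sum b \<rho> n \<le> 1 * cf_sum b \<rho> n"
    using assms by (intro mult_right_mono) auto
  then show ?thesis using cf_sum_shift_le[OF assms, of n] by simp
qed

lemma cf_sum_pos:
  assumes "1 \<le> b"
  shows "cf_sum b \<rho> n > 0"
proof -
  have "replicate n 1 \<in> cf_words n" by (auto simp: cf_words_def)
  then have "(\<Sum>w\<in>{replicate n 1}. ennreal (cf_weight b w powr (-2 * \<rho>))) \<le> cf_sum b \<rho> n"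
    unfolding cf_sum_def by (intro sum_le_nn_integral_count_space) auto
  moreover have "0 < cf_weight b (replicate n 1)"
    using cf_weight_ge(2)[OF assms, of "replicate n 1"] by auto
  then have "(0::ennreal) < (\<Sum>w\<in>{replicate n 1}. ennreal (cf_weight b w powr (-2 * \<rho>)))"
    by simp
  ultimately show ?thesis by (rule less_le_trans[rotated])
qed

subsection \<open>The dimension number as a critical exponent\<close>

lemma cf_sum_one_le:
  assumes "1 \<le> b"
  shows "cf_sum b 1 n \<le> ennreal (2 * b powr (-2 * real n))"
proof -
  have le: "cf_weight b w powr (-2 * 1) \<le> 2 * b powr (-2 * real n) * (1 / (cf_den w 0 * cf_den w 1))"
    if "w \<in> cf_words n" for w
  proof -
    have w: "0 \<notin> set w" "length w = n" using that by (auto simp: cf_words_def)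
    have d: "1 \<le> cf_den w 0" "cf_den w 0 \<le> cf_den w 1" "cf_den w 1 \<le> 2 * cf_den w 0"
      using cf_den_ge_1[OF w(1), of 0] cf_den_bounds[OF w(1), of 1] by auto
    have "cf_den w 0 * cf_den w 1 \<le> 2 * (cf_den w 0 * cf_den w 0)"
      using d mult_left_mono[of "cf_den w 1" "2 * cf_den w 0" "cf_den w 0"] by simp
    then have "1 / (cf_den w 0 * cf_den w 0) \<le> 2 * (1 / (cf_den w 0 * cf_den w 1))"
      using d by (simp add: divide_simps)
    moreover have "cf_weight b w powr (-2 * 1) = b powr (-2 * real n) * (1 / (cf_den w 0 * cf_den w 0))"
    proof -
      have "cf_weight b w powr (-2 * 1) = (b ^ n) powr (-2) * cf_den w 0 powr (-2)"
        using assms d w by (simp add: cf_weight_def powr_mult)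
      also have "(b ^ n) powr (-2) = b powr (-2 * real n)"
        using assms by (simp add: powr_realpow[symmetric] powr_powr mult.commute)
      also have "cf_den w 0 powr (-2) = 1 / (cf_den w 0 * cf_den w 0)"
        using d by (simp add: powr_minus_divide power2_eq_square)
      finally show ?thesis .
    qed
    ultimately show ?thesis
      using mult_left_mono[of "1 / (cf_den w 0 * cf_den w 0)" "2 * (1 / (cf_den w 0 * cf_den w 1))"
          "b powr (-2 * real n)"] by (simp add: mult_ac)
  qed
  have "cf_sum b 1 n \<le> (\<integral>\<^sup>+w. ennreal (2 * b powr (-2 * real n)) * ennreal (1 / (cf_den w 0 * cf_den w 1))
      \<partial>count_space (cf_words n))"
    unfolding cf_sum_def
  proof (rule nn_integral_mono)
    fix w assume "w \<in> space (count_space (cf_words n))"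
    then have w: "w \<in> cf_words n" by simp
    have "0 \<le> 1 / (cf_den w 0 * cf_den w 1)"
      using w cf_den_ge_1[of w 0] cf_den_ge_1[of w 1] by (auto simp: cf_words_def)
    then have "ennreal (2 * b powr (-2 * real n)) * ennreal (1 / (cf_den w 0 * cf_den w 1))
      = ennreal (2 * b powr (-2 * real n) * (1 / (cf_den w 0 * cf_den w 1)))"
      by (intro ennreal_mult[symmetric]) auto
    then show "ennreal (cf_weight b w powr (-2 * 1))
      \<le> ennreal (2 * b powr (-2 * real n)) * ennreal (1 / (cf_den w 0 * cf_den w 1))"
      using le[OF w] by (simp only: ennreal_leI)
  qed
  also have "\<dots> = ennreal (2 * b powr (-2 * real n))"
    by (simp add: nn_integral_cmult nn_integral_cf_words_length)
  finally show ?thesis .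
qed

lemma cf_sum_geometric_bound:
  assumes b: "1 \<le> b" and \<rho>: "0 \<le> \<rho>" and N: "1 \<le> N" "cf_sum b \<rho> N < 1"
  shows "\<exists>C \<theta>. 0 < C \<and> 0 < \<theta> \<and> \<theta> < 1 \<and> (\<forall>n. cf_sum b \<rho> n \<le> ennreal (C * \<theta> ^ n))"
proof -
  have fin1: "cf_sum b \<rho> 1 < top"
  proof (rule ccontr)
    assume "\<not> cf_sum b \<rho> 1 < top"
    then have "cf_sum b \<rho> 1 * cf_sum b \<rho> (N - 1) = top"
      using cf_sum_pos[OF b, of \<rho> "N - 1"] by (simp add: ennreal_top_mult less_top[symmetric])
    then have "ennreal (2 powr (2 * \<rho>)) * cf_sum b \<rho> N = top"
      using cf_sum_mult_le[OF b \<rho>, of 1 "N - 1"] N(1) by (simp add: top_unique)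
    then show False using N(2) by (auto simp: ennreal_mult_eq_top_iff)
  qed
  define M where "M = max 1 (enn2real (cf_sum b \<rho> 1))"
  have M: "1 \<le> M" "cf_sum b \<rho> 1 \<le> ennreal M"
    using fin1 ennreal_leI[of "enn2real (cf_sum b \<rho> 1)" M] by (auto simp: M_def ennreal_enn2real)
  define q where "q = max (1 / 2) (enn2real (cf_sum b \<rho> N))"
  have finN: "cf_sum b \<rho> N < top" using N(2) by (auto intro: less_trans)
  have "ennreal (enn2real (cf_sum b \<rho> N)) < ennreal 1" using N(2) finN by (simp add: ennreal_enn2real)
  then have q: "0 < q" "q < 1" "cf_sum b \<rho> N \<le> ennreal q"
    using finN by (auto simp: q_def ennreal_less_iff intro: ennreal_leI order.trans[OF _ ennreal_leI[of "enn2real (cf_sum b \<rho> N)"]] simp: ennreal_enn2real)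
  define \<theta> where "\<theta> = root N q"
  have \<theta>: "0 < \<theta>" "\<theta> < 1" "\<theta> ^ N = q"
    using q N(1) by (auto simp: \<theta>_def)
  have z: "cf_sum b \<rho> 0 = 1"
    by (simp add: cf_sum_def cf_words_0 cf_weight_def nn_integral_count_space_finite)
  have pow: "cf_sum b \<rho> (m * k) \<le> cf_sum b \<rho> m ^ k" for m k
  proof (induction k)
    case (Suc k)
    have "cf_sum b \<rho> (m * Suc k) \<le> cf_sum b \<rho> m * cf_sum b \<rho> (m * k)"
      using cf_sum_add_le[OF b \<rho>, of m "m * k"] by simp
    also have "\<dots> \<le> cf_sum b \<rho> m ^ Suc k" using Suc by (simp add: mult_left_mono)
    finally show ?case .
  qed (simp add: z)
  have "cf_sum b \<rho> n \<le> ennreal (M ^ N / q * \<theta> ^ n)" for n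
  proof -
    define k r where "k = n div N" and "r = n mod N"
    have n: "n = N * k + 1 * r" "r < N" using N(1) by (auto simp: k_def r_def)
    have "cf_sum b \<rho> n \<le> cf_sum b \<rho> (N * k) * cf_sum b \<rho> (1 * r)"
      unfolding n(1) by (rule cf_sum_add_le[OF b \<rho>])
    also have "\<dots> \<le> ennreal q ^ k * ennreal M ^ r"
      by (intro mult_mono order.trans[OF pow] power_mono q M) auto
    also have "\<dots> = ennreal (q ^ k * M ^ r)" using q M by (simp add: ennreal_power ennreal_mult)
    also have "q ^ k * M ^ r \<le> M ^ N / q * \<theta> ^ n"
    proof -
      have "\<theta> ^ N \<le> \<theta> ^ r" using \<theta> n(2) by (intro power_decreasing) auto
      then have "M ^ r * q \<le> M ^ N * \<theta> ^ r" using \<theta> M n(2) q by (intro mult_mono power_increasing) auto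
      then have "M ^ r \<le> M ^ N / q * \<theta> ^ r" using q by (simp add: field_simps)
      then have "q ^ k * M ^ r \<le> q ^ k * (M ^ N / q * \<theta> ^ r)" using q by (intro mult_left_mono) auto
      also have "\<dots> = M ^ N / q * \<theta> ^ n" by (simp add: n(1) power_add power_mult \<theta>(3) mult_ac)
      finally show ?thesis .
    qed
    finally show ?thesis by (simp add: ennreal_leI)
  qed
  moreover have "0 < M ^ N / q" using M q by simp
  ultimately show ?thesis using \<theta> by blast
qed

definition cf_crit :: "real \<Rightarrow> real" where
  "cf_crit b = Inf {\<rho>. 0 \<le> \<rho> \<and> (\<exists>n\<ge>1. cf_sum b \<rho> n < 1)}"

context
  fixes b :: real
  assumes b: "1 < b"
begin

lemma cf_crit_set_nonempty: "\<exists>\<rho>\<ge>0. \<exists>n\<ge>1. cf_sum b \<rho> n < 1"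
proof -
  have "(\<lambda>n. 2 * b powr (-2 * real n)) \<longlonglongrightarrow> 0"
  proof -
    have "(\<lambda>n. 2 * (b powr (-2)) ^ n) \<longlonglongrightarrow> 2 * 0"
      using b powr_less_one[of b "-2"] by (intro tendsto_intros LIMSEQ_power_zero) auto
    then show ?thesis using b by (simp add: powr_realpow[symmetric] powr_powr)
  qed
  then have "\<forall>\<^sub>F n in sequentially. 2 * b powr (-2 * real n) < 1" by (rule order_tendstoD) simp
  then obtain n0 where "\<And>n. n \<ge> n0 \<Longrightarrow> 2 * b powr (-2 * real n) < 1" by (auto simp: eventually_sequentially)
  then have "2 * b powr (-2 * real (Suc n0)) < 1" by (meson le_SucI order_refl)
  then have "ennreal (2 * b powr (-2 * real (Suc n0))) < ennreal 1" by (intro ennreal_lessI) auto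
  then have "cf_sum b 1 (Suc n0) < 1" using cf_sum_one_le[of b "Suc n0"] b by (auto intro: le_less_trans)
  then show ?thesis by (intro exI[of _ 1] conjI exI[of _ "Suc n0"]) auto
qed

lemma cf_crit_nonneg: "0 \<le> cf_crit b"
  unfolding cf_crit_def using cf_crit_set_nonempty by (intro cInf_greatest) auto

lemma cf_sum_ge_1_below_crit:
  assumes "0 \<le> \<rho>" "\<rho> < cf_crit b" "1 \<le> n"
  shows "1 \<le> cf_sum b \<rho> n"
proof (rule ccontr)
  assume "\<not> 1 \<le> cf_sum b \<rho> n"
  then have "cf_crit b \<le> \<rho>" unfolding cf_crit_def using assms
    by (intro cInf_lower) (auto simp: bdd_below_def not_le intro: exI[of _ 0])
  then show False using assms by simp
qed

lemma cf_sum_geometric_above_crit: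
  assumes "cf_crit b < \<rho>"
  shows "\<exists>C \<theta>. 0 < C \<and> 0 < \<theta> \<and> \<theta> < 1 \<and> (\<forall>n. cf_sum b \<rho> n \<le> ennreal (C * \<theta> ^ n))"
proof -
  obtain \<rho>0 N where *: "\<rho>0 < \<rho>" "0 \<le> \<rho>0" "1 \<le> N" "cf_sum b \<rho>0 N < 1"
    using cInf_lessD[OF _ assms[unfolded cf_crit_def]] cf_crit_set_nonempty by auto
  have "cf_sum b \<rho> N \<le> cf_sum b \<rho>0 N" using b * by (intro cf_sum_antimono) auto
  then show ?thesis using * b by (intro cf_sum_geometric_bound[of _ _ N]) (auto intro: le_less_trans)
qed

lemma cf_sum_unbounded_below_crit:
  assumes "0 \<le> t" "t < cf_crit b"
  shows "\<exists>n. ennreal K < cf_sum b t n"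
proof -
  obtain t' where t': "t < t'" "t' < cf_crit b" using assms dense by blast
  define \<beta> where "\<beta> = b powr (2 * (t' - t))"
  have "\<beta> > 1" using b t' by (auto simp: \<beta>_def)
  then obtain n where n: "K < \<beta> ^ n" using real_arch_pow by blast
  have "K < \<beta> ^ Suc n" using n \<open>\<beta> > 1\<close> power_strict_increasing[of n "Suc n" \<beta>] by linarith
  define m where "m = Suc n"
  have m: "K < \<beta> ^ m" "m \<ge> 1" using \<open>K < \<beta> ^ Suc n\<close> by (auto simp: m_def)
  have "\<beta> ^ m = b powr (2 * real m * (t' - t))"
    using b by (simp add: \<beta>_def powr_realpow[symmetric] powr_powr mult_ac)
  then have inv: "\<beta> ^ m * b powr (-2 * real m * (t' - t)) = 1"
    using b by (simp add: powr_add[symmetric])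
  have "ennreal (\<beta> ^ m) = ennreal (\<beta> ^ m) * 1" by simp
  also have "\<dots> \<le> ennreal (\<beta> ^ m) * cf_sum b t' m"
    using cf_sum_ge_1_below_crit[of t' m] t' assms m by (intro mult_left_mono) auto
  also have "\<dots> \<le> ennreal (\<beta> ^ m) * (ennreal (b powr (-2 * real m * (t' - t))) * cf_sum b t m)"
    using b t' by (intro mult_left_mono cf_sum_shift_le) auto
  also have "\<dots> = cf_sum b t m"
    using inv \<open>\<beta> > 1\<close> by (simp add: mult.assoc[symmetric] ennreal_mult[symmetric])
  finally have "ennreal (\<beta> ^ m) \<le> cf_sum b t m" .
  moreover have "ennreal K < ennreal (\<beta> ^ m)" using m \<open>\<beta> > 1\<close> by (intro ennreal_lessI) auto
  ultimately show ?thesis by (auto intro: less_le_trans)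
qed

lemma cf_pre_dim_tendsto_crit:
  "(\<lambda>n. Inf {\<rho>. 0 \<le> \<rho> \<and> cf_sum b \<rho> n \<le> 1}) \<longlonglongrightarrow> cf_crit b"
proof (rule order_tendstoI)
  have bdd: "bdd_below {\<rho>. 0 \<le> \<rho> \<and> cf_sum b \<rho> n \<le> 1}" for n by (auto simp: bdd_below_def intro: exI[of _ 0])
  have ev: "\<forall>\<^sub>F n in sequentially. cf_sum b \<rho> n \<le> 1" if crit: "cf_crit b < \<rho>" for \<rho>
  proof -
    obtain C \<theta> where C: "0 < C" "0 < \<theta>" "\<theta> < 1" "\<And>n. cf_sum b \<rho> n \<le> ennreal (C * \<theta> ^ n)"
      using cf_sum_geometric_above_crit[OF crit] by blast
    have "(\<lambda>n. C * \<theta> ^ n) \<longlonglongrightarrow> C * 0" using C by (intro tendsto_intros LIMSEQ_power_zero) auto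
    then have "\<forall>\<^sub>F n in sequentially. C * \<theta> ^ n < 1" by (rule order_tendstoD) simp
    then show ?thesis
    proof eventually_elim
      case (elim n)
      then have "ennreal (C * \<theta> ^ n) \<le> ennreal 1" by (intro ennreal_leI) auto
      then show ?case using C(4)[of n] by (simp add: order.trans)
    qed
  qed
  have ge: "cf_crit b \<le> \<rho>" if "1 \<le> n" "0 \<le> \<rho>" "cf_sum b \<rho> n \<le> 1" for n \<rho>
  proof (rule dense_ge)
    fix \<rho>' assume \<rho>': "\<rho> < \<rho>'"
    have "cf_sum b \<rho>' n \<le> ennreal (b powr (-2 * real n * (\<rho>' - \<rho>))) * cf_sum b \<rho> n"
      using b \<rho>' by (intro cf_sum_shift_le) auto
    also have "\<dots> \<le> ennreal (b powr (-2 * real n * (\<rho>' - \<rho>))) * 1" using that by (intro mult_left_mono) auto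
    also have "\<dots> < ennreal 1"
      using b \<rho>' that powr_less_one[of b "-2 * real n * (\<rho>' - \<rho>)"]
      by (simp add: ennreal_less_iff mult_neg_pos del: ennreal_1)
    finally show "cf_crit b \<le> \<rho>'"
      using cf_sum_ge_1_below_crit[of \<rho>' n] that \<rho>' by (force simp: not_le)
  qed
  fix a
  { assume "a < cf_crit b"
    have "\<forall>\<^sub>F n in sequentially. cf_sum b (cf_crit b + 1) n \<le> 1 \<and> 1 \<le> n"
      using ev[of "cf_crit b + 1"] eventually_ge_at_top[of 1] by (auto intro: eventually_conj)
    then show "\<forall>\<^sub>F n in sequentially. a < Inf {\<rho>. 0 \<le> \<rho> \<and> cf_sum b \<rho> n \<le> 1}"
    proof eventually_elim
      case (elim n)
      have "cf_crit b + 1 \<in> {\<rho>. 0 \<le> \<rho> \<and> cf_sum b \<rho> n \<le> 1}" using elim cf_crit_nonneg by auto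
      then have "cf_crit b \<le> Inf {\<rho>. 0 \<le> \<rho> \<and> cf_sum b \<rho> n \<le> 1}"
        using elim ge by (intro cInf_greatest) auto
      then show ?case using \<open>a < cf_crit b\<close> by simp
    qed }
  { assume "cf_crit b < a"
    then obtain \<rho> where \<rho>: "cf_crit b < \<rho>" "\<rho> < a" using dense by blast
    show "\<forall>\<^sub>F n in sequentially. Inf {\<rho>. 0 \<le> \<rho> \<and> cf_sum b \<rho> n \<le> 1} < a"
      using ev[OF \<rho>(1)]
    proof eventually_elim
      case (elim n)
      then have "Inf {\<rho>. 0 \<le> \<rho> \<and> cf_sum b \<rho> n \<le> 1} \<le> \<rho>"
        using \<rho>(1) cf_crit_nonneg bdd by (intro cInf_lower) auto
      then show ?case using \<rho> by simp
    qed }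
qed

end

lemma cf_sum_one_base_unbounded:
  assumes "0 \<le> t" "t < 1"
  shows "\<exists>n. ennreal K < cf_sum 1 t n"
proof -
  define \<beta> :: real where "\<beta> = 2 powr (2 * (1 - t))"
  have "\<beta> > 1" using assms by (auto simp: \<beta>_def)
  then obtain n where n: "K < \<beta> ^ n" using real_arch_pow by blast
  have le: "\<beta> ^ n * (1 / (cf_den w 0 * cf_den w 1)) \<le> cf_weight 1 w powr (-2 * t)"
    if "w \<in> cf_words (2 * n)" for w
  proof -
    have w: "0 \<notin> set w" "length w = 2 * n" using that by (auto simp: cf_words_def)
    have d: "1 \<le> cf_den w 0" "cf_den w 0 \<le> cf_den w 1"
      using cf_den_ge_1[OF w(1), of 0] cf_den_bounds[OF w(1), of 1] by auto
    have "\<beta> ^ n = (2 ^ n) powr (2 * (1 - t))"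
      by (simp add: \<beta>_def powr_realpow[symmetric] powr_powr mult_ac)
    also have "\<dots> \<le> cf_den w 0 powr (2 * (1 - t))"
      using two_power_le_cf_den[OF w] assms by (intro powr_mono2) auto
    finally have "\<beta> ^ n \<le> cf_den w 0 powr (2 * (1 - t))" .
    moreover have "1 / (cf_den w 0 * cf_den w 1) \<le> cf_den w 0 powr (-2)"
      using d by (simp add: powr_minus_divide power2_eq_square frac_le mult_left_mono)
    ultimately have "\<beta> ^ n * (1 / (cf_den w 0 * cf_den w 1)) \<le> cf_den w 0 powr (2 * (1 - t)) * cf_den w 0 powr (-2)"
      using d by (intro mult_mono) auto
    also have "\<dots> = cf_weight 1 w powr (-2 * t)"
      by (simp add: cf_weight_def powr_add[symmetric] algebra_simps)
    finally show ?thesis .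
  qed
  have "ennreal K < ennreal (\<beta> ^ n)" using n \<open>\<beta> > 1\<close> by (intro ennreal_lessI) auto
  also have "\<dots> = (\<integral>\<^sup>+w. ennreal (\<beta> ^ n) * ennreal (1 / (cf_den w 0 * cf_den w 1)) \<partial>count_space (cf_words (2 * n)))"
    by (simp add: nn_integral_cmult nn_integral_cf_words_length)
  also have "\<dots> \<le> cf_sum 1 t (2 * n)"
    unfolding cf_sum_def
  proof (rule nn_integral_mono)
    fix w assume "w \<in> space (count_space (cf_words (2 * n)))"
    then have w: "w \<in> cf_words (2 * n)" by simp
    have "0 \<le> \<beta> ^ n" "0 \<le> cf_den w 0 * cf_den w 1"
      using \<open>\<beta> > 1\<close> w cf_den_ge_1[of w 0] cf_den_ge_1[of w 1] by (auto simp: cf_words_def)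
    then show "ennreal (\<beta> ^ n) * ennreal (1 / (cf_den w 0 * cf_den w 1)) \<le> ennreal (cf_weight 1 w powr (-2 * t))"
      using le[OF w] by (subst ennreal_mult[symmetric]) (auto intro!: ennreal_leI)
  qed
  finally show ?thesis by blast
qed

lemma bij_betw_PiE_cf_words:
  "bij_betw (\<lambda>a. map a [1..<Suc n]) (PiE {1..n} (\<lambda>_. {1..})) (cf_words n)"
proof (rule bij_betw_byWitness[where f' = "\<lambda>w. restrict (\<lambda>k. w ! (k - 1)) {1..n}"])
  show "\<forall>a\<in>PiE {1..n} (\<lambda>_. {1::nat..}). restrict (\<lambda>k. map a [1..<Suc n] ! (k - 1)) {1..n} = a"
  proof (rule ballI)
    fix a :: "nat \<Rightarrow> nat" assume a: "a \<in> PiE {1..n} (\<lambda>_. {1..})"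
    show "restrict (\<lambda>k. map a [1..<Suc n] ! (k - 1)) {1..n} = a"
    proof (rule ext)
      fix k show "restrict (\<lambda>k. map a [1..<Suc n] ! (k - 1)) {1..n} k = a k"
        using a by (auto simp: restrict_def PiE_def extensional_def nth_map simp del: upt_Suc)
    qed
  qed
  show "\<forall>w\<in>cf_words n. map (restrict (\<lambda>k. w ! (k - 1)) {1..n}) [1..<Suc n] = w"
    by (auto simp: cf_words_def simp del: upt_Suc intro!: nth_equalityI)
  show "(\<lambda>a. map a [1..<Suc n]) ` PiE {1..n} (\<lambda>_. {1..}) \<subseteq> cf_words n"
    by (fastforce simp: cf_words_def PiE_def Pi_def simp del: upt_Suc)
  show "(\<lambda>w. restrict (\<lambda>k. w ! (k - 1)) {1..n}) ` cf_words n \<subseteq> PiE {1..n} (\<lambda>_. {1..})"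
  proof (intro image_subsetI PiE_I)
    fix w k assume w: "w \<in> cf_words n" and k: "k \<in> {1..n}"
    then have "w ! (k - 1) \<in> set w" by (intro nth_mem) (auto simp: cf_words_def)
    then have "w ! (k - 1) \<noteq> 0" using w by (metis (mono_tags, lifting) cf_words_def mem_Collect_eq)
    then show "restrict (\<lambda>k. w ! (k - 1)) {1..n} k \<in> {1..}" using k by simp
  qed auto
qed

lemma pre_dim_number_eq_cf_sum:
  assumes "0 \<le> \<nu>" "0 < t"
  shows "pre_dim_number (\<nu> / (1 + \<nu>)) t n = Inf {\<rho>. 0 \<le> \<rho> \<and> cf_sum (t powr \<nu>) \<rho> n \<le> 1}"
proof -
  have \<alpha>: "real n * (\<nu> / (1 + \<nu>)) / (1 - \<nu> / (1 + \<nu>)) = real n * \<nu>"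
  proof -
    have "1 - \<nu> / (1 + \<nu>) = 1 / (1 + \<nu>)" using assms by (simp add: field_simps)
    then show ?thesis using assms by simp
  qed
  have "(\<Sum>\<^sub>\<infinity>a\<in>PiE {1..n} (\<lambda>_. {1..}).
      ennreal ((1 / (t powr (real n * \<nu>) * real (cf_denom a n))) powr (2 * \<rho>)))
      = cf_sum (t powr \<nu>) \<rho> n" for \<rho>
  proof -
    have "(\<Sum>\<^sub>\<infinity>a\<in>PiE {1..n} (\<lambda>_. {1..}).
        ennreal ((1 / (t powr (real n * \<nu>) * real (cf_denom a n))) powr (2 * \<rho>)))
        = (\<Sum>\<^sub>\<infinity>a\<in>PiE {1..n} (\<lambda>_. {1..}). ennreal (cf_weight (t powr \<nu>) (map a [1..<Suc n]) powr (-2 * \<rho>)))"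
    proof (rule infsum_cong)
      fix a :: "nat \<Rightarrow> nat" assume "a \<in> PiE {1..n} (\<lambda>_. {1..})"
      then have "map a [1..<Suc n] \<in> cf_words n" by (rule bij_betwE[OF bij_betw_PiE_cf_words, rule_format])
      then have w: "0 \<notin> set (map a [1..<Suc n])" by (simp add: cf_words_def)
      have "cf_weight (t powr \<nu>) (map a [1..<Suc n]) = t powr (real n * \<nu>) * real (cf_denom a n)"
        unfolding cf_weight_def cf_den_eq_cf_denom[OF w] using assms
        by (simp add: powr_realpow[symmetric] powr_powr mult_ac del: upt_Suc)
      moreover have "0 < t powr (real n * \<nu>) * real (cf_denom a n)"
        using cf_den_ge_1[OF w, of 0] assms unfolding cf_den_eq_cf_denom[OF w] by simp
      ultimately show "ennreal ((1 / (t powr (real n * \<nu>) * real (cf_denom a n))) powr (2 * \<rho>))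
          = ennreal (cf_weight (t powr \<nu>) (map a [1..<Suc n]) powr (-2 * \<rho>))"
        by (simp add: powr_divide powr_minus_divide del: upt_Suc)
    qed
    also have "\<dots> = infsum (\<lambda>w. ennreal (cf_weight (t powr \<nu>) w powr (-2 * \<rho>))) (cf_words n)"
      by (rule infsum_reindex_bij_betw[OF bij_betw_PiE_cf_words])
    also have "\<dots> = cf_sum (t powr \<nu>) \<rho> n"
      unfolding cf_sum_def by (rule infsum_eq_nn_integral_count_space) simp
    finally show ?thesis .
  qed
  then show ?thesis by (simp only: pre_dim_number_def \<alpha>)
qed

lemma dim_number_eq_cf_crit:
  assumes "0 < \<nu>" "1 < t"
  shows "dim_number (\<nu> / (1 + \<nu>)) t = cf_crit (t powr \<nu>)"
proof -
  have "1 < t powr \<nu>" using assms by simp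
  from cf_pre_dim_tendsto_crit[OF this]
  have "(\<lambda>n. pre_dim_number (\<nu> / (1 + \<nu>)) t n) \<longlonglongrightarrow> cf_crit (t powr \<nu>)"
    using assms by (simp add: pre_dim_number_eq_cf_sum)
  then show ?thesis using assms by (simp add: dim_number_def limI)
qed

subsection \<open>Hausdorff dimension\<close>

lemma hausdorff_dim_le:
  assumes "0 \<le> s" "hausdorff_measure s E = 0"
  shows "hausdorff_dim E \<le> ereal s"
  unfolding hausdorff_dim_def using assms by (intro Inf_lower) auto

lemma hausdorff_dim_nonneg: "0 \<le> hausdorff_dim E"
  unfolding hausdorff_dim_def by (intro Inf_greatest) auto

lemma hausdorff_measure_eq_0I:
  fixes E :: "'a::metric_space set"
  assumes cover: "\<And>\<epsilon> \<delta>. 0 < \<epsilon> \<Longrightarrow> 0 < \<delta> \<Longrightarrow> \<exists>(I :: 'i set) U. countable I \<and> E \<subseteq> (\<Union>i\<in>I. U i) \<and>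
    (\<forall>i\<in>I. bounded (U i) \<and> diameter (U i) \<le> \<delta>) \<and>
    (\<integral>\<^sup>+i. hausdorff_gauge s (U i) \<partial>count_space I) \<le> ennreal \<epsilon>"
  shows "hausdorff_measure s E = 0"
proof -
  have *: "hausdorff_pre_measure s \<delta> E \<le> ennreal \<epsilon>" if pos: "0 < \<epsilon>" "0 < \<delta>" for \<epsilon> \<delta>
  proof -
    obtain I :: "'i set" and U where U: "countable I" "E \<subseteq> (\<Union>i\<in>I. U i)"
      "\<And>i. i \<in> I \<Longrightarrow> bounded (U i) \<and> diameter (U i) \<le> \<delta>"
      "(\<integral>\<^sup>+i. hausdorff_gauge s (U i) \<partial>count_space I) \<le> ennreal \<epsilon>"
      using cover[OF pos] by blast
    define J where "J = to_nat_on I ` I"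
    define V where "V k = (if k \<in> J then U (from_nat_into I k) else {})" for k
    have bij: "bij_betw (to_nat_on I) I J"
      using U(1) by (auto simp: J_def bij_betw_def inj_on_to_nat_on)
    have J: "from_nat_into I k \<in> I" if "k \<in> J" for k
      using that U(1) by (auto simp: J_def)
    have "(\<Sum>k. hausdorff_gauge s (V k)) = (\<integral>\<^sup>+k. hausdorff_gauge s (V k) \<partial>count_space UNIV)"
      by (simp add: nn_integral_count_space_nat)
    also have "\<dots> = (\<integral>\<^sup>+k. hausdorff_gauge s (V k) \<partial>count_space J)"
      by (rule nn_integral_count_space_eq) (auto simp: V_def hausdorff_gauge_def)
    also have "\<dots> = (\<integral>\<^sup>+i. hausdorff_gauge s (V (to_nat_on I i)) \<partial>count_space I)"
      by (rule nn_integral_bij_count_space[OF bij, symmetric])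
    also have "\<dots> = (\<integral>\<^sup>+i. hausdorff_gauge s (U i) \<partial>count_space I)"
      by (intro nn_integral_cong) (use U(1) in \<open>auto simp: V_def J_def\<close>)
    finally have le: "(\<Sum>k. hausdorff_gauge s (V k)) \<le> ennreal \<epsilon>" using U(4) by simp
    have "E \<subseteq> (\<Union>k. V k)"
    proof
      fix x assume "x \<in> E"
      then obtain i where i: "i \<in> I" "x \<in> U i" using U(2) by auto
      then have "x \<in> V (to_nat_on I i)" using U(1) by (auto simp: V_def J_def)
      then show "x \<in> (\<Union>k. V k)" by blast
    qed
    moreover have "\<forall>k. bounded (V k) \<and> diameter (V k) \<le> \<delta>"
      using U(3)[OF J] pos by (auto simp: V_def)
    ultimately have "hausdorff_pre_measure s \<delta> E \<le> (\<Sum>k. hausdorff_gauge s (V k))"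
      unfolding hausdorff_pre_measure_def by (intro Inf_lower) blast
    with le show ?thesis by simp
  qed
  have "hausdorff_pre_measure s \<delta> E = 0" if "0 < \<delta>" for \<delta>
  proof -
    have le: "hausdorff_pre_measure s \<delta> E \<le> 0 + ennreal \<epsilon>" if "0 < \<epsilon>" for \<epsilon>
      using * \<open>0 < \<delta>\<close> that by simp
    have "hausdorff_pre_measure s \<delta> E \<le> 0" by (rule ennreal_le_epsilon) (rule le)
    then show ?thesis by simp
  qed
  then show ?thesis by (simp add: hausdorff_measure_def)
qed

text \<open>The image of Lebesgue measure on the unit interval under \<open>g\<close> is a Frostman measure, but no
  measurability of \<open>g\<close> is needed.\<close>

lemma hausdorff_dim_ge_of_inverse_Hoelder:
  fixes g :: "real \<Rightarrow> real"
  assumes g: "\<And>u. u \<in> {0..<1} \<Longrightarrow> g u \<in> E \<inter> {0..1}"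
    and C: "0 \<le> C" and t: "0 < t"
    and H: "\<And>u u'. u \<in> {0..<1} \<Longrightarrow> u' \<in> {0..<1} \<Longrightarrow> \<bar>u - u'\<bar> \<le> C * \<bar>g u - g u'\<bar> powr t"
  shows "ereal t \<le> hausdorff_dim E"
  unfolding hausdorff_dim_def
proof (intro Inf_greatest, clarify)
  fix s assume s: "0 \<le> s" "hausdorff_measure s E = 0"
  show "ereal t \<le> ereal s"
  proof (rule ccontr)
    assume "\<not> ereal t \<le> ereal s"
    then have st: "s < t" by simp
    define \<epsilon> where "\<epsilon> = 1 / (2 * C + 1)"
    have \<epsilon>: "0 < \<epsilon>" "2 * C * \<epsilon> < 1" using C by (auto simp: \<epsilon>_def field_simps)
    have "hausdorff_pre_measure s 1 E \<le> hausdorff_measure s E"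
      unfolding hausdorff_measure_def by (intro SUP_upper) auto
    then have "hausdorff_pre_measure s 1 E < ennreal \<epsilon>" using s(2) \<epsilon> by simp
    then obtain U where U: "(\<Sum>k. hausdorff_gauge s (U k)) < ennreal \<epsilon>" "E \<subseteq> (\<Union>k. U k)"
      "\<And>k. bounded (U k) \<and> diameter (U k) \<le> 1"
      unfolding hausdorff_pre_measure_def Inf_less_iff by auto
    have "\<exists>B. (\<forall>u\<in>{0..<1}. g u \<in> U k \<longrightarrow> u \<in> B) \<and> B \<in> sets lborel
        \<and> emeasure lborel B \<le> ennreal (2 * C) * hausdorff_gauge s (U k)" for k
    proof (cases "\<exists>u0\<in>{0..<1}. g u0 \<in> U k")
      case False
      then show ?thesis by (intro exI[of _ "{}"]) auto
    next
      case True
      then obtain u0 where u0: "u0 \<in> {0..<1}" "g u0 \<in> U k" by blast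
      define \<gamma> where "\<gamma> = (if s = 0 then 1 else diameter (U k) powr s)"
      have \<gamma>: "hausdorff_gauge s (U k) = ennreal \<gamma>" "0 \<le> \<gamma>"
        using u0 by (auto simp: hausdorff_gauge_def \<gamma>_def)
      have "u \<in> {u0 - C * \<gamma>..u0 + C * \<gamma>}" if u: "u \<in> {0..<1}" "g u \<in> U k" for u
      proof -
        have d: "\<bar>g u - g u0\<bar> \<le> diameter (U k)"
          using diameter_bounded_bound[of "U k" "g u" "g u0"] U(3) u u0 by (auto simp: dist_real_def)
        have "\<bar>g u - g u0\<bar> powr t \<le> \<gamma>"
        proof (cases "g u = g u0")
          case True
          then show ?thesis using \<gamma> t by simp
        next
          case False
          have "\<bar>g u - g u0\<bar> powr t \<le> \<bar>g u - g u0\<bar> powr s"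
            using False d U(3)[of k] st by (intro powr_mono') auto
          also have "\<dots> \<le> \<gamma>"
            using d False s by (auto simp: \<gamma>_def intro: powr_mono2)
          finally show ?thesis .
        qed
        then have "C * \<bar>g u - g u0\<bar> powr t \<le> C * \<gamma>" using C by (intro mult_left_mono)
        then have "\<bar>u - u0\<bar> \<le> C * \<gamma>" using H[OF u(1) u0(1)] by linarith
        then show ?thesis by auto
      qed
      moreover have "emeasure lborel {u0 - C * \<gamma>..u0 + C * \<gamma>} = ennreal (2 * C) * hausdorff_gauge s (U k)"
        using \<gamma> C by (simp add: ennreal_mult[symmetric])
      ultimately show ?thesis by (intro exI[of _ "{u0 - C * \<gamma>..u0 + C * \<gamma>}"]) auto
    qed
    then have "\<exists>B. \<forall>k. (\<forall>u\<in>{0..<1}. g u \<in> U k \<longrightarrow> u \<in> B k) \<and> B k \<in> sets lborel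
        \<and> emeasure lborel (B k) \<le> ennreal (2 * C) * hausdorff_gauge s (U k)"
      by (intro choice allI)
    then obtain B where B': "\<forall>k. (\<forall>u\<in>{0..<1}. g u \<in> U k \<longrightarrow> u \<in> B k) \<and> B k \<in> sets lborel
        \<and> emeasure lborel (B k) \<le> ennreal (2 * C) * hausdorff_gauge s (U k)"
      by (elim exE)
    have B: "u \<in> {0..<1} \<Longrightarrow> g u \<in> U k \<Longrightarrow> u \<in> B k" "B k \<in> sets lborel"
      "emeasure lborel (B k) \<le> ennreal (2 * C) * hausdorff_gauge s (U k)" for k u
      using B'[rule_format, of k] by auto
    have "{0..<1} \<subseteq> (\<Union>k. B k)"
    proof
      fix u :: real assume u: "u \<in> {0..<1}"
      then obtain k where "g u \<in> U k" using g U(2) by blast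
      with u B(1) show "u \<in> (\<Union>k. B k)" by blast
    qed
    then have "emeasure lborel {0..<1::real} \<le> emeasure lborel (\<Union>k. B k)"
      using B(2) by (intro emeasure_mono) auto
    also have "\<dots> \<le> (\<Sum>k. emeasure lborel (B k))"
      using B(2) by (intro emeasure_subadditive_countably) auto
    also have "\<dots> \<le> (\<Sum>k. ennreal (2 * C) * hausdorff_gauge s (U k))"
      using B(3) by (intro suminf_le) auto
    also have "\<dots> = ennreal (2 * C) * (\<Sum>k. hausdorff_gauge s (U k))" by simp
    also have "\<dots> \<le> ennreal (2 * C) * ennreal \<epsilon>" using U(1) by (intro mult_left_mono) auto
    also have "\<dots> < ennreal 1" using \<epsilon> C by (subst ennreal_mult[symmetric]) (auto intro!: ennreal_lessI)
    finally show False by simp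
  qed
qed

lemma hausdorff_dim_le_one:
  fixes E :: "real set"
  assumes "E \<subseteq> {0..1}"
  shows "hausdorff_dim E \<le> 1"
proof (rule dense_ge)
  fix x :: ereal assume x: "1 < x"
  have *: "hausdorff_dim E \<le> ereal s" if s: "1 < s" for s
  proof (rule hausdorff_dim_le)
    show "hausdorff_measure s E = 0"
    proof (rule hausdorff_measure_eq_0I)
      fix \<epsilon> \<delta> :: real assume "0 < \<epsilon>" "0 < \<delta>"
      have "(\<lambda>n. real n powr (1 - s)) \<longlonglongrightarrow> 0"
        using s by (intro tendsto_neg_powr filterlim_real_sequentially) auto
      then have "\<forall>\<^sub>F n in sequentially. real n powr (1 - s) < \<epsilon> / 2"
        using \<open>0 < \<epsilon>\<close> by (intro order_tendstoD(2)) auto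
      moreover have "\<forall>\<^sub>F n in sequentially. 1 / real n < \<delta>"
        using \<open>0 < \<delta>\<close> by (intro order_tendstoD(2)[OF lim_1_over_n])
      ultimately have "\<forall>\<^sub>F n in sequentially. real n powr (1 - s) < \<epsilon> / 2 \<and> 1 / real n < \<delta> \<and> 1 \<le> n"
        using eventually_ge_at_top[of 1] by eventually_elim auto
      then obtain N where N: "real N powr (1 - s) < \<epsilon> / 2" "1 / real N < \<delta>" "1 \<le> N"
        by (auto simp: eventually_sequentially)
      define U where "U j = {real j / real N..(real j + 1) / real N}" for j :: nat
      have d: "diameter (U j) = 1 / real N" for j
        using N(3) by (simp add: U_def diameter_closed_interval divide_simps)
      have "E \<subseteq> (\<Union>j\<in>{..N}. U j)"
      proof
        fix x assume "x \<in> E"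
        then have x: "0 \<le> x" "x \<le> 1" using assms by auto
        define j where "j = nat \<lfloor>x * real N\<rfloor>"
        have j: "real j \<le> x * real N" "x * real N < real j + 1" using x by (auto simp: j_def)
        have "x * real N \<le> 1 * real N" using x by (intro mult_right_mono) auto
        then have "j \<le> N" using j by linarith
        moreover have "x \<in> U j" using j N(3) by (simp add: U_def field_simps)
        ultimately show "x \<in> (\<Union>j\<in>{..N}. U j)" by blast
      qed
      moreover have "(\<integral>\<^sup>+j. hausdorff_gauge s (U j) \<partial>count_space {..N}) \<le> ennreal \<epsilon>"
      proof -
        have "(\<integral>\<^sup>+j. hausdorff_gauge s (U j) \<partial>count_space {..N}) = (\<Sum>j\<le>N. hausdorff_gauge s (U j))"
          by (simp add: nn_integral_count_space_finite)
        also have "\<dots> \<le> (\<Sum>j\<le>N. ennreal ((1 / real N) powr s))"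
          using s by (intro sum_mono) (auto simp: hausdorff_gauge_def d)
        also have "\<dots> = ennreal (\<Sum>j\<le>N. (1 / real N) powr s)" by (subst sum_ennreal) auto
        also have "(\<Sum>j\<le>N. (1 / real N) powr s) = (real N + 1) * (1 / real N) powr s" by simp
        also have "\<dots> \<le> (2 * real N) * (1 / real N) powr s" using N(3) by (intro mult_right_mono) auto
        also have "\<dots> = 2 * real N powr (1 - s)"
          using N(3) by (simp add: powr_diff powr_divide)
        also have "\<dots> \<le> \<epsilon>" using N(1) by simp
        finally show ?thesis by (simp add: ennreal_leI)
      qed
      ultimately show "\<exists>(I :: nat set) U. countable I \<and> E \<subseteq> (\<Union>i\<in>I. U i) \<and>
        (\<forall>i\<in>I. bounded (U i) \<and> diameter (U i) \<le> \<delta>) \<and>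
        (\<integral>\<^sup>+i. hausdorff_gauge s (U i) \<partial>count_space I) \<le> ennreal \<epsilon>"
        using N(2) d by (intro exI[of _ "{..N}"] exI[of _ U]) (auto simp: U_def)
    qed
  qed (use s in auto)
  show "hausdorff_dim E \<le> x"
    using x *[of "real_of_ereal x"] by (cases x) auto
qed

subsection \<open>Gauss map and the fixed point\<close>

lemma gauss_map_inverse_add:
  assumes "1 \<le> a" "0 \<le> z" "z < 1"
  shows "gauss_map (1 / (real a + z)) = z"
proof -
  have "frac (real a + z) = z" using assms by (simp add: frac_unique_iff)
  then show ?thesis using assms by (simp add: gauss_map_def)
qed

lemma gauss_map_funpow_cf_map:
  assumes "0 \<notin> set w" "0 < z" "z < 1"
  shows "(gauss_map ^^ length w) (cf_map w z) = z"
    and "0 < cf_map w z \<and> cf_map w z < 1"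
proof -
  have "(gauss_map ^^ length w) (cf_map w z) = z \<and> 0 < cf_map w z \<and> cf_map w z < 1"
    using assms
  proof (induction w)
    case (Cons a w)
    then have a: "1 \<le> a" "real a \<ge> 1" by (cases a; simp)+
    then have "gauss_map (1 / (real a + cf_map w z)) = cf_map w z"
      using Cons by (intro gauss_map_inverse_add) auto
    then show ?case using Cons a by (simp add: funpow_swap1 del: funpow.simps) (simp add: funpow_Suc_right del: funpow.simps)
  qed auto
  then show "(gauss_map ^^ length w) (cf_map w z) = z" "0 < cf_map w z \<and> cf_map w z < 1" by auto
qed

lemma gauss_map_range: "0 \<le> gauss_map x" "gauss_map x < 1"
  by (auto simp: gauss_map_def frac_lt_1)

lemma gauss_map_funpow_range:
  assumes "x \<in> {0..<1}"
  shows "(gauss_map ^^ n) x \<in> {0..<1}"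
  using assms gauss_map_range by (cases n) auto

lemma eq_inverse_floor_add_gauss_map:
  assumes "0 < x" "x < 1"
  shows "1 \<le> \<lfloor>1 / x\<rfloor>" "x = 1 / (of_int \<lfloor>1 / x\<rfloor> + gauss_map x)"
proof -
  show "1 \<le> \<lfloor>1 / x\<rfloor>" using assms by (simp add: le_floor_iff)
  have "of_int \<lfloor>1 / x\<rfloor> + gauss_map x = 1 / x" using assms by (simp add: gauss_map_def frac_def)
  then show "x = 1 / (of_int \<lfloor>1 / x\<rfloor> + gauss_map x)" by simp
qed

lemma gauss_map_0: "gauss_map 0 = 0" "(gauss_map ^^ n) 0 = 0"
proof -
  show z: "gauss_map 0 = 0" by (simp add: gauss_map_def)
  show "(gauss_map ^^ n) 0 = 0" by (induction n) (simp_all add: z)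
qed

lemma exists_cf_map_funpow:
  assumes "x \<in> {0..<1}" "(gauss_map ^^ n) x \<noteq> 0"
  shows "\<exists>w\<in>cf_words n. x = cf_map w ((gauss_map ^^ n) x)"
  using assms
proof (induction n arbitrary: x)
  case 0
  then show ?case by (auto simp: cf_words_0)
next
  case (Suc n)
  have x: "0 < x" "x < 1" using Suc.prems gauss_map_0 by (cases "x = 0"; auto)+
  have e: "(gauss_map ^^ Suc n) x = (gauss_map ^^ n) (gauss_map x)" by (simp add: funpow_swap1)
  obtain w where w: "w \<in> cf_words n" "gauss_map x = cf_map w ((gauss_map ^^ n) (gauss_map x))"
    using Suc.IH[of "gauss_map x"] Suc.prems(2) gauss_map_range[of x] unfolding e by auto
  define a where "a = nat \<lfloor>1 / x\<rfloor>"
  note f = eq_inverse_floor_add_gauss_map[OF x]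
  have "x = cf_map (a # w) ((gauss_map ^^ Suc n) x)"
  proof -
    have "real a = of_int \<lfloor>1 / x\<rfloor>" using f(1) unfolding a_def by (intro of_nat_nat) linarith
    then have "cf_map (a # w) ((gauss_map ^^ Suc n) x) = 1 / (of_int \<lfloor>1 / x\<rfloor> + gauss_map x)"
      unfolding e by (simp add: w(2)[symmetric])
    then show ?thesis using f(2) by (simp only:)
  qed
  moreover have "a # w \<in> cf_words (Suc n)" using w f(1) by (auto simp: cf_words_def a_def)
  ultimately show ?case by blast
qed

lemma eq_cf_map_replicate:
  assumes "x \<in> {0..<1}" "\<And>k. k \<in> {1..n} \<Longrightarrow> partial_quotient k x = int i" "1 \<le> i"
  shows "x = cf_map (replicate n i) ((gauss_map ^^ n) x)"
  using assms
proof (induction n arbitrary: x)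
  case (Suc n)
  have p1: "\<lfloor>1 / x\<rfloor> = int i" using Suc.prems(2)[of 1] by (simp add: partial_quotient_def)
  then have x: "0 < x" "x < 1" using Suc.prems(1,3) by (cases "x = 0"; auto)+
  have e: "(gauss_map ^^ Suc n) x = (gauss_map ^^ n) (gauss_map x)" for n by (simp add: funpow_swap1)
  have "partial_quotient k (gauss_map x) = int i" if "k \<in> {1..n}" for k
  proof -
    have "partial_quotient k (gauss_map x) = partial_quotient (Suc k) x"
      using that e[of "k - 1"] by (simp add: partial_quotient_def)
    then show ?thesis using Suc.prems(2)[of "Suc k"] that by simp
  qed
  then have "gauss_map x = cf_map (replicate n i) ((gauss_map ^^ n) (gauss_map x))"
    using gauss_map_range[of x] Suc.prems(3) by (intro Suc.IH) auto
  then have "cf_map (replicate (Suc n) i) ((gauss_map ^^ Suc n) x) = 1 / (of_int \<lfloor>1 / x\<rfloor> + gauss_map x)"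
    unfolding e p1 by simp
  then show ?case using eq_inverse_floor_add_gauss_map(2)[OF x] by (simp only:)
qed auto

context
  fixes i :: nat
  assumes i: "1 \<le> i"
begin

lemma tau_gt_1: "1 < tau i"
proof -
  have "sqrt 4 < sqrt ((real i)\<^sup>2 + 4)" using i by (intro real_sqrt_less_mono) simp
  then show ?thesis using i by (simp add: tau_def)
qed

lemma tau_eq: "real i + const_cf i = tau i"
  by (simp add: tau_def const_cf_def field_simps)

lemma cf_map_replicate_const_cf: "cf_map (replicate n i) (const_cf i) = const_cf i"
proof (induction n)
  case (Suc n)
  have "const_cf i = 1 / (real i + const_cf i)"
    using inverse_const_cf[OF i] const_cf_bounds[OF i] by (simp add: field_simps)
  then show ?case using Suc by simp
qed auto

lemma cf_den_replicate_const_cf: "cf_den (replicate n i) (const_cf i) = tau i ^ n"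
  by (induction n) (auto simp: cf_map_replicate_const_cf tau_eq)

lemma cf_den_replicate_bounds:
  "cf_den (replicate n i) 0 \<le> tau i ^ n" "tau i ^ n \<le> 2 * cf_den (replicate n i) 0"
proof -
  have "0 \<notin> set (replicate n i)" using i by auto
  from cf_den_bounds[OF this, of "const_cf i"] const_cf_bounds[OF i]
  show "cf_den (replicate n i) 0 \<le> tau i ^ n" "tau i ^ n \<le> 2 * cf_den (replicate n i) 0"
    by (auto simp: cf_den_replicate_const_cf)
qed

lemma measure_basic_interval:
  "measure lborel (basic_interval n (const_cf i))
    = 1 / (cf_den (replicate n i) 0 * cf_den (replicate n i) 1)"
proof -
  let ?w = "replicate n i" and ?B = "basic_interval n (const_cf i)"
  let ?l = "min (cf_map ?w 0) (cf_map ?w 1)" and ?h = "max (cf_map ?w 0) (cf_map ?w 1)"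
  have w: "0 \<notin> set ?w" using i by auto
  note img = cf_map_image_unit_interval[OF w]
  have sub1: "{?l<..<?h} \<subseteq> ?B"
  proof
    fix x assume "x \<in> {?l<..<?h}"
    then have "x \<in> cf_map ?w ` {0<..<1}" by (simp only: img)
    then obtain z where z: "0 < z" "z < 1" "x = cf_map ?w z" by auto
    have "partial_quotient k x = int i" if "k \<in> {1..n}" for k
    proof -
      define u where "u = cf_map (replicate (n - k) i) z"
      have u: "0 < u" "u < 1"
        using gauss_map_funpow_cf_map(2)[of "replicate (n - k) i" z] z i by (auto simp: u_def)
      have "?w = replicate ((k - 1) + Suc (n - k)) i"
        using that by (intro arg_cong[of _ _ "\<lambda>m. replicate m i"]) auto
      also have "\<dots> = replicate (k - 1) i @ [i] @ replicate (n - k) i"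
        by (simp only: replicate_add replicate_Suc append_Cons append_Nil)
      finally have "x = cf_map (replicate (k - 1) i) (1 / (real i + u))"
        by (simp only: z(3) cf_map_append) (simp add: u_def)
      then have "(gauss_map ^^ (k - 1)) x = 1 / (real i + u)"
        using gauss_map_funpow_cf_map(1)[of "replicate (k - 1) i" "1 / (real i + u)"] u i by auto
      then show ?thesis using u by (simp add: partial_quotient_def floor_eq_iff)
    qed
    then show "x \<in> ?B"
      using gauss_map_funpow_cf_map(2)[OF w z(1,2)] z
      by (auto simp: basic_interval_def partial_quotient_const_cf[OF i])
  qed
  have sub2: "?B \<subseteq> {?l<..<?h} \<union> {cf_map ?w 0}"
  proof
    fix x assume x: "x \<in> ?B"
    have e: "x = cf_map ?w ((gauss_map ^^ n) x)"
      using x by (intro eq_cf_map_replicate) (use i in \<open>auto simp: basic_interval_def partial_quotient_const_cf[OF i]\<close>)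
    have r: "(gauss_map ^^ n) x \<in> {0..<1}"
      using x by (intro gauss_map_funpow_range) (auto simp: basic_interval_def)
    show "x \<in> {?l<..<?h} \<union> {cf_map ?w 0}"
    proof (cases "(gauss_map ^^ n) x = 0")
      case True
      then show ?thesis using e by (metis UnI2 singletonI)
    next
      case False
      then have "cf_map ?w ((gauss_map ^^ n) x) \<in> {?l<..<?h}"
        unfolding img[symmetric] using r by (intro imageI) auto
      then show ?thesis using e by (metis UnI1)
    qed
  qed
  have eq: "?B = {?l<..<?h} \<union> (?B \<inter> {cf_map ?w 0})" using sub1 sub2 by blast
  have fin: "finite (?B \<inter> {cf_map ?w 0})" by simp
  have "measure lborel ?B = measure lborel {?l<..<?h}"
    by (subst eq, rule measure_Un_null_set) (auto intro: finite_imp_null_set_lborel fin)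
  then show ?thesis using measure_cf_map_image[OF w] img by simp
qed

lemma measure_basic_interval_bounds:
  "1 / (2 * tau i ^ (2 * n)) \<le> measure lborel (basic_interval n (const_cf i))"
  "measure lborel (basic_interval n (const_cf i)) \<le> 4 / tau i ^ (2 * n)"
  "measure lborel (basic_interval n (const_cf i)) \<le> 1"
proof -
  let ?a = "cf_den (replicate n i) 0" and ?b = "cf_den (replicate n i) 1"
  have w: "0 \<notin> set (replicate n i)" using i by auto
  have d: "1 \<le> ?a" "?a \<le> ?b" "?b \<le> 2 * ?a" "?a \<le> tau i ^ n" "tau i ^ n \<le> 2 * ?a" "1 \<le> ?b"
    using cf_den_ge_1[OF w, of 0] cf_den_ge_1[OF w, of 1] cf_den_bounds[OF w, of 1] cf_den_replicate_bounds[of n] by auto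
  have t: "0 < tau i" using tau_gt_1 by simp
  have sq: "tau i ^ (2 * n) = tau i ^ n * tau i ^ n" by (simp add: mult_2 power_add)
  have "?a * ?b \<le> tau i ^ n * (2 * tau i ^ n)" using d t by (intro mult_mono) auto
  then show "1 / (2 * tau i ^ (2 * n)) \<le> measure lborel (basic_interval n (const_cf i))"
    unfolding measure_basic_interval sq using d t by (intro divide_left_mono mult_pos_pos) auto
  have "tau i ^ n * tau i ^ n \<le> (2 * ?a) * (2 * ?b)" using d t by (intro mult_mono) auto
  then have "tau i ^ (2 * n) \<le> 4 * (?a * ?b)" by (simp add: sq)
  then show "measure lborel (basic_interval n (const_cf i)) \<le> 4 / tau i ^ (2 * n)"
    unfolding measure_basic_interval using d t by (simp add: field_simps)
  have "1 * 1 \<le> ?a * ?b" using d by (intro mult_mono) auto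
  then show "measure lborel (basic_interval n (const_cf i)) \<le> 1"
    unfolding measure_basic_interval by (simp add: divide_le_eq)
qed

lemma infinite_hits_of_less_asymp_exponent:
  assumes "0 \<le> v" "ereal v < asymp_exponent (const_cf i) x"
  shows "infinite {n. \<bar>(gauss_map ^^ n) x - const_cf i\<bar>
    < measure lborel (basic_interval n (const_cf i)) powr v}"
proof -
  obtain v' where v': "v < v'" and inf: "infinite {n. \<bar>(gauss_map ^^ n) x - const_cf i\<bar>
      < measure lborel (basic_interval n (const_cf i)) powr v'}"
    using assms(2) unfolding asymp_exponent_def less_Sup_iff by auto
  have "measure lborel (basic_interval n (const_cf i)) powr v'
      \<le> measure lborel (basic_interval n (const_cf i)) powr v" for n
    using v' measure_basic_interval_bounds(3)[of n] by (intro powr_mono') auto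
  then show ?thesis by (intro infinite_super[OF _ inf]) (auto intro: less_le_trans)
qed

end

subsection \<open>Upper bound\<close>

lemma diameter_cf_map_image_le:
  assumes w: "0 \<notin> set w" and A: "A \<subseteq> {0..<1}" "\<And>z. z \<in> A \<Longrightarrow> \<bar>z - y\<bar> \<le> d" and d: "0 \<le> d"
  shows "bounded (cf_map w ` A)" "diameter (cf_map w ` A) \<le> 2 * d / (cf_den w 0)\<^sup>2"
proof -
  have "cf_map w ` A \<subseteq> {0..1}" using cf_map_bounds[OF w] A(1) by force
  then show "bounded (cf_map w ` A)" by (rule bounded_subset[rotated]) simp
  show "diameter (cf_map w ` A) \<le> 2 * d / (cf_den w 0)\<^sup>2"
  proof (rule diameter_le)
    show "cf_map w ` A \<noteq> {} \<or> 0 \<le> 2 * d / (cf_den w 0)\<^sup>2" using d by simp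
    fix x x' assume "x \<in> cf_map w ` A" "x' \<in> cf_map w ` A"
    then obtain z z' where z: "z \<in> A" "z' \<in> A" "x = cf_map w z" "x' = cf_map w z'" by blast
    have "\<bar>z - z'\<bar> \<le> 2 * d" using A(2)[OF z(1)] A(2)[OF z(2)] by linarith
    have "norm (x - x') \<le> \<bar>z - z'\<bar> / (cf_den w 0)\<^sup>2"
      unfolding z real_norm_def using z A(1) by (intro abs_cf_map_diff_le[OF w]) auto
    also have "\<dots> \<le> 2 * d / (cf_den w 0)\<^sup>2" using \<open>\<bar>z - z'\<bar> \<le> 2 * d\<close> by (intro divide_right_mono) auto
    finally show "norm (x - x') \<le> 2 * d / (cf_den w 0)\<^sup>2" .
  qed
qed

lemma hausdorff_measure_level_set_eq_0:
  assumes i: "1 \<le> i" and \<nu>: "0 < \<nu>" and \<rho>: "cf_crit (tau i powr \<nu>) < \<rho>"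
  shows "hausdorff_measure \<rho> {x \<in> {0..<1}. asymp_exponent (const_cf i) x = ereal \<nu>} = 0"
proof -
  define T where "T = tau i"
  define y where "y = const_cf i"
  define b where "b = T powr \<nu>"
  have T: "1 < T" using tau_gt_1[OF i] by (simp add: T_def)
  have y: "0 < y" "y < 1" using const_cf_bounds[OF i] by (auto simp: y_def)
  have b: "1 < b" using T \<nu> by (simp add: b_def)
  obtain C \<theta> where C: "0 < C" "0 < \<theta>" "\<theta> < 1" "\<And>n. cf_sum b \<rho> n \<le> ennreal (C * \<theta> ^ n)"
    using cf_sum_geometric_above_crit[OF b, of \<rho>] \<rho> unfolding b_def T_def by blast
  have \<rho>0: "0 < \<rho>" using cf_crit_nonneg[OF b] \<rho> by (simp add: b_def T_def)
  define \<eta> where "\<eta> = min (\<nu> / 2) (- ln \<theta> / (4 * \<rho> * ln T))"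
  have lnT: "0 < ln T" using T by simp
  have ln\<theta>: "ln \<theta> < 0" using C by simp
  have \<eta>: "0 < \<eta>" "\<eta> < \<nu>" using \<nu> lnT ln\<theta> \<rho>0 by (auto simp: \<eta>_def intro!: divide_neg_pos mult_pos_pos)
  define v where "v = \<nu> - \<eta>"
  have v: "0 < v" "v < \<nu>" using \<eta> by (auto simp: v_def)
  define \<sigma> where "\<sigma> = T powr (2 * \<eta> * \<rho>)"
  define \<kappa> where "\<kappa> = \<sigma> * \<theta>"
  have \<kappa>: "0 < \<kappa>" "\<kappa> < 1"
  proof -
    show "0 < \<kappa>" using T C by (simp add: \<kappa>_def \<sigma>_def)
    have "\<eta> \<le> - ln \<theta> / (4 * \<rho> * ln T)" by (simp add: \<eta>_def)
    then have "2 * \<eta> * \<rho> * ln T \<le> - ln \<theta> / 2" using \<rho>0 lnT by (simp add: field_simps)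
    then have "2 * \<eta> * \<rho> * ln T + ln \<theta> < 0" using ln\<theta> by linarith
    then have "exp (2 * \<eta> * \<rho> * ln T + ln \<theta>) < 1" by simp
    then show "\<kappa> < 1" using T C by (simp add: \<kappa>_def \<sigma>_def powr_def exp_add)
  qed
  define d where "d n = 4 powr v * T powr (-2 * real n * v)" for n :: nat
  have d0: "0 < d n" for n using T by (simp add: d_def)
  have Id: "measure lborel (basic_interval n y) powr v \<le> d n" for n
  proof -
    have "measure lborel (basic_interval n y) powr v \<le> (4 / T ^ (2 * n)) powr v"
      unfolding y_def T_def using v measure_basic_interval_bounds(2)[OF i] by (intro powr_mono2) auto
    also have "\<dots> = d n" using T by (simp add: d_def powr_divide powr_realpow[symmetric] powr_powr powr_minus_divide)
    finally show ?thesis .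
  qed
  define A where "A = (2 * 4 powr v) powr \<rho>"
  have A: "0 < A" by (simp add: A_def)
  define S where "S n = {z \<in> {0..<1}. \<bar>z - y\<bar> < d n}" for n
  define U where "U p = (if snd p \<in> cf_words (fst p) then cf_map (snd p) ` S (fst p) else {})" for p
  have US: "bounded (U (n, w))" "diameter (U (n, w)) \<le> 2 * d n / (cf_den w 0)\<^sup>2"
    and Uc: "hausdorff_gauge \<rho> (U (n, w)) \<le> ennreal (A * \<sigma> ^ n) * ennreal (cf_weight b w powr (-2 * \<rho>))"
    if w: "w \<in> cf_words n" for n w
  proof -
    have w0: "0 \<notin> set w" "length w = n" using w by (auto simp: cf_words_def)
    show *: "bounded (U (n, w))" "diameter (U (n, w)) \<le> 2 * d n / (cf_den w 0)\<^sup>2"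
    proof -
      have S: "S n \<subseteq> {0..<1}" "\<And>z. z \<in> S n \<Longrightarrow> \<bar>z - y\<bar> \<le> d n" by (auto simp: S_def)
      show "bounded (U (n, w))" "diameter (U (n, w)) \<le> 2 * d n / (cf_den w 0)\<^sup>2"
        using diameter_cf_map_image_le[OF w0(1) S less_imp_le[OF d0]] w by (simp_all add: U_def)
    qed
    have Q: "1 \<le> cf_den w 0" using cf_den_ge_1[OF w0(1)] by simp
    have "hausdorff_gauge \<rho> (U (n, w)) \<le> ennreal (diameter (U (n, w)) powr \<rho>)"
      using \<rho>0 by (auto simp: hausdorff_gauge_def)
    also have "\<dots> \<le> ennreal ((2 * d n / (cf_den w 0)\<^sup>2) powr \<rho>)"
      using * \<rho>0 by (intro ennreal_leI powr_mono2 diameter_ge_0) auto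
    also have "(2 * d n / (cf_den w 0)\<^sup>2) powr \<rho> = A * \<sigma> ^ n * cf_weight b w powr (-2 * \<rho>)"
    proof -
      have "(2 * d n / (cf_den w 0)\<^sup>2) powr \<rho>
          = A * T powr (-2 * real n * v * \<rho>) * cf_den w 0 powr (-2 * \<rho>)"
      proof -
        have "d n powr \<rho> = (4 powr v) powr \<rho> * T powr (-2 * real n * v * \<rho>)"
          using T unfolding d_def by (subst powr_mult) (simp_all only: powr_powr)
        moreover have "A = 2 powr \<rho> * (4 powr v) powr \<rho>"
          unfolding A_def by (rule powr_mult)
        moreover have "((cf_den w 0)\<^sup>2) powr \<rho> = cf_den w 0 powr (2 * \<rho>)"
        proof -
          have "(cf_den w 0)\<^sup>2 = cf_den w 0 powr 2" using Q by simp
          then show ?thesis by (simp only: powr_powr)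
        qed
        moreover have "cf_den w 0 powr (-2 * \<rho>) = 1 / cf_den w 0 powr (2 * \<rho>)"
          by (simp add: powr_minus_divide)
        moreover have "(2 * d n / (cf_den w 0)\<^sup>2) powr \<rho> = 2 powr \<rho> * d n powr \<rho> / ((cf_den w 0)\<^sup>2) powr \<rho>"
          by (simp only: powr_divide powr_mult)
        ultimately show ?thesis by simp
      qed
      also have "T powr (-2 * real n * v * \<rho>) = \<sigma> ^ n * (b ^ n) powr (-2 * \<rho>)"
      proof -
        have "\<sigma> ^ n = T powr (2 * \<eta> * \<rho> * real n)" "b ^ n = T powr (\<nu> * real n)"
          unfolding \<sigma>_def b_def using T by (simp_all add: powr_power mult_ac)
        moreover have "2 * \<eta> * \<rho> * real n + \<nu> * real n * (-2 * \<rho>) = -2 * real n * v * \<rho>"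
          by (simp add: v_def algebra_simps)
        ultimately show ?thesis by (simp only: powr_powr powr_add[symmetric])
      qed
      finally show ?thesis using b Q w0 by (simp add: cf_weight_def powr_mult)
    qed
    finally show "hausdorff_gauge \<rho> (U (n, w)) \<le> ennreal (A * \<sigma> ^ n) * ennreal (cf_weight b w powr (-2 * \<rho>))"
      using A T by (simp add: ennreal_mult[symmetric] \<sigma>_def)
  qed
  have row: "(\<integral>\<^sup>+w. hausdorff_gauge \<rho> (U (n, w)) \<partial>count_space UNIV) \<le> ennreal (A * C * \<kappa> ^ n)" for n
  proof -
    have "(\<integral>\<^sup>+w. hausdorff_gauge \<rho> (U (n, w)) \<partial>count_space UNIV)
        = (\<integral>\<^sup>+w. hausdorff_gauge \<rho> (U (n, w)) \<partial>count_space (cf_words n))"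
      by (rule nn_integral_count_space_eq) (auto simp: U_def hausdorff_gauge_def)
    also have "\<dots> \<le> (\<integral>\<^sup>+w. ennreal (A * \<sigma> ^ n) * ennreal (cf_weight b w powr (-2 * \<rho>)) \<partial>count_space (cf_words n))"
      by (intro nn_integral_mono Uc) simp
    also have "\<dots> = ennreal (A * \<sigma> ^ n) * cf_sum b \<rho> n"
      by (simp add: cf_sum_def nn_integral_cmult)
    also have "\<dots> \<le> ennreal (A * \<sigma> ^ n) * ennreal (C * \<theta> ^ n)" by (intro mult_left_mono C) auto
    also have "\<dots> = ennreal (A * C * \<kappa> ^ n)"
      using A C by (subst ennreal_mult[symmetric]) (auto simp: \<kappa>_def \<sigma>_def power_mult_distrib mult_ac)
    finally show ?thesis .
  qed
  show ?thesis
  proof (rule hausdorff_measure_eq_0I)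
    fix \<epsilon> \<delta> :: real assume \<epsilon>: "0 < \<epsilon>" and \<delta>: "0 < \<delta>"
    have "d \<longlonglongrightarrow> 0"
    proof -
      have "(\<lambda>n. 4 powr v * (T powr (-2 * v)) ^ n) \<longlonglongrightarrow> 4 powr v * 0"
        using T v powr_less_one[of T "-2 * v"] by (intro tendsto_intros LIMSEQ_power_zero) auto
      then show ?thesis using T by (simp add: d_def[abs_def] powr_realpow[symmetric] powr_powr mult_ac)
    qed
    then have "\<forall>\<^sub>F n in sequentially. d n < min (\<delta> / 2) y"
      using \<delta> y by (intro order_tendstoD(2)) auto
    moreover have "(\<lambda>n. A * C * \<kappa> ^ n / (1 - \<kappa>)) \<longlonglongrightarrow> A * C * 0 / (1 - \<kappa>)"
      using \<kappa> by (intro tendsto_intros LIMSEQ_power_zero) auto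
    then have "\<forall>\<^sub>F n in sequentially. A * C * \<kappa> ^ n / (1 - \<kappa>) < \<epsilon>"
      using \<epsilon> by (intro order_tendstoD(2)) auto
    ultimately have "\<forall>\<^sub>F n in sequentially. d n < min (\<delta> / 2) y \<and> A * C * \<kappa> ^ n / (1 - \<kappa>) < \<epsilon>"
      by eventually_elim auto
    then obtain N where N: "\<And>n. N \<le> n \<Longrightarrow> d n < \<delta> / 2" "\<And>n. N \<le> n \<Longrightarrow> d n < y"
      "A * C * \<kappa> ^ N / (1 - \<kappa>) < \<epsilon>"
      by (auto simp: eventually_sequentially)
    let ?I = "{N..} \<times> (UNIV :: nat list set)"
    have cov: "{x \<in> {0..<1}. asymp_exponent (const_cf i) x = ereal \<nu>} \<subseteq> (\<Union>p\<in>?I. U p)"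
    proof clarify
      fix x assume x: "x \<in> {0..<1}" "asymp_exponent (const_cf i) x = ereal \<nu>"
      have "infinite {n. \<bar>(gauss_map ^^ n) x - const_cf i\<bar> < measure lborel (basic_interval n (const_cf i)) powr v}"
        using x v by (intro infinite_hits_of_less_asymp_exponent[OF i]) auto
      then obtain n where n: "N \<le> n" "\<bar>(gauss_map ^^ n) x - y\<bar> < measure lborel (basic_interval n y) powr v"
        unfolding infinite_nat_iff_unbounded_le y_def by blast
      have lt: "\<bar>(gauss_map ^^ n) x - y\<bar> < d n" using n(2) Id[of n] by simp
      then have "(gauss_map ^^ n) x \<noteq> 0" using N(2)[OF n(1)] y by auto
      then obtain w where w: "w \<in> cf_words n" "x = cf_map w ((gauss_map ^^ n) x)"
        using exists_cf_map_funpow[OF x(1)] by blast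
      have "(gauss_map ^^ n) x \<in> S n" using gauss_map_funpow_range[OF x(1)] lt by (simp add: S_def)
      then have "cf_map w ((gauss_map ^^ n) x) \<in> U (n, w)" using w(1) by (simp add: U_def)
      then have "x \<in> U (n, w)" using w(2) by metis
      then show "x \<in> (\<Union>p\<in>?I. U p)" using n(1) by blast
    qed
    have diam: "bounded (U p) \<and> diameter (U p) \<le> \<delta>" if p: "p \<in> ?I" for p
    proof -
      obtain n w where nw: "p = (n, w)" "N \<le> n" using p by auto
      show ?thesis
      proof (cases "w \<in> cf_words n")
        case True
        then have Q: "1 \<le> (cf_den w 0)\<^sup>2" using cf_den_ge_1[of w 0] by (auto simp: cf_words_def)
        have "2 * d n / (cf_den w 0)\<^sup>2 \<le> 2 * d n / 1"
          using Q d0[of n] by (intro divide_left_mono) auto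
        then show ?thesis using US[OF True] N(1)[OF nw(2)] nw by auto
      next
        case False
        then show ?thesis using nw \<delta> by (simp add: U_def)
      qed
    qed
    have tot: "(\<integral>\<^sup>+p. hausdorff_gauge \<rho> (U p) \<partial>count_space ?I) \<le> ennreal \<epsilon>"
    proof -
      have "(\<integral>\<^sup>+p. hausdorff_gauge \<rho> (U p) \<partial>count_space ?I)
          = (\<integral>\<^sup>+n. \<integral>\<^sup>+w. hausdorff_gauge \<rho> (U (n, w)) \<partial>count_space UNIV \<partial>count_space {N..})"
        using nn_integral_count_space_Times[where f = "\<lambda>n w. hausdorff_gauge \<rho> (U (n, w))" and A = "{N..}" and B = UNIV]
        by simp
      also have "\<dots> \<le> (\<integral>\<^sup>+n. ennreal (A * C * \<kappa> ^ n) \<partial>count_space {N..})"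
        by (intro nn_integral_mono row)
      also have "\<dots> = (\<integral>\<^sup>+k. ennreal (A * C * \<kappa> ^ (N + k)) \<partial>count_space UNIV)"
      proof (rule nn_integral_bij_count_space[symmetric])
        show "bij_betw (\<lambda>k. N + k) UNIV {N..}"
          by (rule bij_betw_byWitness[where f' = "\<lambda>n. n - N"]) auto
      qed
      also have "\<dots> = (\<Sum>k. ennreal (A * C * \<kappa> ^ (N + k)))" by (rule nn_integral_count_space_nat)
      also have "\<dots> = ennreal (A * C * \<kappa> ^ N / (1 - \<kappa>))"
      proof (rule suminf_ennreal_eq)
        show "0 \<le> A * C * \<kappa> ^ (N + k)" for k using A C \<kappa> by simp
        have "(\<lambda>k. A * C * \<kappa> ^ N * \<kappa> ^ k) sums (A * C * \<kappa> ^ N * (1 / (1 - \<kappa>)))"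
          using \<kappa> by (intro sums_mult geometric_sums) auto
        then show "(\<lambda>k. A * C * \<kappa> ^ (N + k)) sums (A * C * \<kappa> ^ N / (1 - \<kappa>))"
          by (simp add: power_add mult_ac)
      qed
      finally show ?thesis using N(3) by (meson ennreal_leI less_imp_le order.trans)
    qed
    show "\<exists>(I :: (nat \<times> nat list) set) U.
        countable I \<and> {x \<in> {0..<1}. asymp_exponent (const_cf i) x = ereal \<nu>} \<subseteq> (\<Union>i\<in>I. U i) \<and>
        (\<forall>i\<in>I. bounded (U i) \<and> diameter (U i) \<le> \<delta>) \<and>
        (\<integral>\<^sup>+i. hausdorff_gauge \<rho> (U i) \<partial>count_space I) \<le> ennreal \<epsilon>"
      using cov diam tot by (intro exI[of _ ?I] exI[of _ U]) auto
  qed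
qed

subsection \<open>Infinite expansions\<close>

definition cf_orbit :: "(nat \<Rightarrow> nat) \<Rightarrow> (nat \<Rightarrow> real) \<Rightarrow> bool" where
  "cf_orbit a z \<longleftrightarrow> (\<forall>n. 0 < z n \<and> z n < 1 \<and> z n = 1 / (real (a n) + z (Suc n)))"

lemma continuous_on_cf_map:
  assumes "0 \<notin> set w"
  shows "continuous_on {0..1} (cf_map w)"
  using assms
proof (induction w)
  case (Cons a w)
  have "real a + cf_map w z \<noteq> 0" if "z \<in> {0..1}" for z
    using cf_map_Cons_denom_ge_1[OF Cons.prems, of z] that by auto
  then show ?case using Cons by (auto intro!: continuous_intros)
qed (simp add: continuous_on_id)

lemma cf_orbit_exists:
  assumes a: "\<And>n. 1 \<le> a n"
  shows "\<exists>z. cf_orbit a z"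
proof -
  have w: "0 \<notin> set (map a [0..<n])" for n using a not_one_le_zero by (metis ex_map_conv)
  define K where "K n = cf_map (map a [0..<n]) ` {0..1}" for n
  have K: "compact (K n) \<and> K n \<noteq> {}" for n
    using continuous_on_cf_map[OF w] by (auto simp: K_def intro!: compact_continuous_image)
  have in01: "0 \<le> 1 / (real (a n) + z)" "1 / (real (a n) + z) \<le> 1" if "0 \<le> z" for n z
    using a[of n] that by (auto simp: divide_simps)
  have ext: "cf_map (map a [0..<Suc n]) z = cf_map (map a [0..<n]) (1 / (real (a n) + z))" for n z
    by (simp add: cf_map_append)
  have "K (Suc n) \<subseteq> K n" for n
  proof
    fix x assume "x \<in> K (Suc n)"
    then obtain z where z: "0 \<le> z" "x = cf_map (map a [0..<Suc n]) z" by (auto simp: K_def)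
    then show "x \<in> K n" unfolding K_def z(2) ext using in01[OF z(1)] by (intro imageI) auto
  qed
  then have "K n \<subseteq> K m" if "m \<le> n" for m n using that by (rule lift_Suc_antimono_le)
  then have "\<Inter> (range K) \<noteq> {}" using K by (intro compact_nest) auto
  then obtain x where x: "\<And>n. x \<in> K n" by blast
  then have "\<exists>z. \<forall>n. 0 \<le> z n \<and> z n \<le> 1 \<and> x = cf_map (map a [0..<n]) (z n)"
    by (intro choice allI) (fastforce simp: K_def)
  then obtain z where z: "\<forall>n. 0 \<le> z n \<and> z n \<le> 1 \<and> x = cf_map (map a [0..<n]) (z n)" ..
  have z0: "0 \<le> z n" "z n \<le> 1" for n using z by auto
  have eq: "z n = 1 / (real (a n) + z (Suc n))" for n
  proof (rule cf_map_inj[OF w z0 in01[OF z0(1)]])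
    have "cf_map (map a [0..<n]) (z n) = x" using z by metis
    also have "\<dots> = cf_map (map a [0..<Suc n]) (z (Suc n))" using z by metis
    also have "\<dots> = cf_map (map a [0..<n]) (1 / (real (a n) + z (Suc n)))" by (rule ext)
    finally show "cf_map (map a [0..<n]) (z n) = cf_map (map a [0..<n]) (1 / (real (a n) + z (Suc n)))" .
  qed
  have pos: "0 < z n" for n
  proof -
    have "0 < real (a n) + z (Suc n)" using a[of n] z0(1)[of "Suc n"] by linarith
    then show ?thesis by (subst eq) simp
  qed
  have "z n < 1" for n
  proof -
    have "1 < real (a n) + z (Suc n)" using a[of n] pos[of "Suc n"] by linarith
    then show ?thesis by (subst eq) simp
  qed
  then show ?thesis using pos eq unfolding cf_orbit_def by blast
qed

lemma cf_orbitD: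
  assumes "cf_orbit a z"
  shows "0 < z n" "z n < 1" "z n = 1 / (real (a n) + z (Suc n))" "1 \<le> a n"
proof -
  show *: "0 < z n" "z n < 1" "z n = 1 / (real (a n) + z (Suc n))"
    using assms unfolding cf_orbit_def by blast+
  show "1 \<le> a n"
  proof (rule ccontr)
    assume "\<not> 1 \<le> a n"
    then have e: "z n = 1 / z (Suc n)" using *(3) by simp
    have "0 < z (Suc n)" "z (Suc n) < 1" using assms unfolding cf_orbit_def by blast+
    then have "1 < 1 / z (Suc n)" by simp
    then show False using *(2) e by linarith
  qed
qed

lemma cf_orbit_shift:
  assumes "cf_orbit a z"
  shows "cf_orbit (\<lambda>k. a (n + k)) (\<lambda>k. z (n + k))"
  unfolding cf_orbit_def
proof (intro allI conjI)
  fix k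
  show "0 < z (n + k)" "z (n + k) < 1" by (rule cf_orbitD[OF assms])+
  show "z (n + k) = 1 / (real (a (n + k)) + z (n + Suc k))"
    using cf_orbitD(3)[OF assms, of "n + k"] by (simp only: add_Suc_right)
qed

lemma cf_orbit_prefix_pos:
  assumes "cf_orbit a z"
  shows "0 \<notin> set (map a ns)"
  using cf_orbitD(4)[OF assms] not_one_le_zero by (metis ex_map_conv)

lemma cf_orbit_eq_cf_map:
  assumes "cf_orbit a z"
  shows "z 0 = cf_map (map a [0..<n]) (z n)"
proof (induction n)
  case (Suc n)
  have "z 0 = cf_map (map a [0..<n]) (z n)" by (rule Suc)
  also have "z n = 1 / (real (a n) + z (Suc n))" by (rule cf_orbitD[OF assms])
  also have "cf_map (map a [0..<n]) \<dots> = cf_map (map a [0..<Suc n]) (z (Suc n))"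
    by (simp add: cf_map_append)
  finally show ?case .
qed simp

lemma gauss_map_funpow_cf_orbit:
  assumes "cf_orbit a z"
  shows "(gauss_map ^^ n) (z 0) = z n"
  using gauss_map_funpow_cf_map(1)[OF cf_orbit_prefix_pos[OF assms] cf_orbitD(1,2)[OF assms], of "[0..<n]" n]
    cf_orbit_eq_cf_map[OF assms, of n] by simp

lemma cf_orbit_separation:
  assumes z: "cf_orbit a z" "cf_orbit a' z'"
    and M: "\<And>n. a n \<le> M" "\<And>n. a' n \<le> M"
    and eq: "\<And>k. k < n \<Longrightarrow> a k = a' k" and ne: "a n \<noteq> a' n"
  shows "1 / (2 * (real M + 3) ^ 3) / (cf_den (map a [0..<n]) 0)\<^sup>2 \<le> \<bar>z 0 - z' 0\<bar>"
proof -
  define \<eta> where "\<eta> = 1 / (real M + 3)"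
  have bd: "\<eta> \<le> z n \<and> z n \<le> 1 - \<eta>" if "cf_orbit a z" "\<And>n. a n \<le> M" for a z n
  proof -
    note o = cf_orbitD[OF that(1)]
    have A: "1 / (real M + 1) \<le> z n" for n
    proof -
      have "0 < real (a n) + z (Suc n)" "real (a n) + z (Suc n) \<le> real M + 1"
        using o(1,2)[of "Suc n"] that(2)[of n] by (auto intro!: add_mono add_nonneg_pos)
      then have "1 / (real M + 1) \<le> 1 / (real (a n) + z (Suc n))"
        by (intro divide_left_mono mult_pos_pos) auto
      then show ?thesis using o(3)[of n] by linarith
    qed
    have "1 + 1 / (real M + 1) \<le> real (a n) + z (Suc n)" using o(4)[of n] A[of "Suc n"] by linarith
    moreover have "0 < 1 + 1 / (real M + 1)" by (intro add_pos_pos) auto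
    ultimately have "1 / (real (a n) + z (Suc n)) \<le> 1 / (1 + 1 / (real M + 1))"
      by (intro divide_left_mono mult_pos_pos) auto
    also have "\<dots> = 1 - 1 / (real M + 2)" by (simp add: divide_simps add_ac)
    also have "\<dots> \<le> 1 - \<eta>" by (simp add: \<eta>_def frac_le)
    finally have "z n \<le> 1 - \<eta>" using o(3)[of n] by linarith
    moreover have "\<eta> \<le> 1 / (real M + 1)" by (simp add: \<eta>_def frac_le)
    ultimately show ?thesis using A[of n] by linarith
  qed
  let ?s = "real (a n) + z (Suc n)" and ?s' = "real (a' n) + z' (Suc n)"
  have s: "0 < ?s" "?s \<le> real M + 1" "0 < ?s'" "?s' \<le> real M + 1"
    using cf_orbitD(1,2)[OF z(1), of "Suc n"] cf_orbitD(1,2)[OF z(2), of "Suc n"] of_nat_mono[OF M(1)[of n], where 'a = real]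
      of_nat_mono[OF M(2)[of n], where 'a = real] of_nat_0_le_iff[of "a n", where 'a = real] of_nat_0_le_iff[of "a' n", where 'a = real]
    by linarith+
  have diff: "2 * \<eta> \<le> \<bar>?s' - ?s\<bar>"
  proof -
    have "\<bar>z (Suc n) - z' (Suc n)\<bar> \<le> 1 - 2 * \<eta>"
      using bd[OF z(1) M(1), of "Suc n"] bd[OF z(2) M(2), of "Suc n"] by linarith
    moreover have "1 \<le> \<bar>real (a' n) - real (a n)\<bar>" using ne by linarith
    ultimately show ?thesis by linarith
  qed
  have "1 / (real M + 3) ^ 3 * 2 \<le> (2 * \<eta>) / ((real M + 1) * (real M + 1))"
  proof -
    have "(real M + 1) * (real M + 1) \<le> (real M + 3) * (real M + 3)" by (intro mult_mono) auto
    then have "2 * \<eta> / ((real M + 3) * (real M + 3)) \<le> (2 * \<eta>) / ((real M + 1) * (real M + 1))"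
      by (intro divide_left_mono) (auto simp: \<eta>_def)
    then show ?thesis by (simp add: \<eta>_def power3_eq_cube mult_ac)
  qed
  also have "\<dots> \<le> \<bar>?s' - ?s\<bar> / (?s * ?s')"
    using s diff by (intro frac_le mult_mono mult_pos_pos) auto
  also have "\<dots> = \<bar>1 / ?s - 1 / ?s'\<bar>"
    using s by (simp add: divide_simps abs_mult)
  also have "\<dots> = \<bar>z n - z' n\<bar>" using cf_orbitD(3)[OF z(1), of n] cf_orbitD(3)[OF z(2), of n] by (simp only:)
  finally have step: "1 / (real M + 3) ^ 3 * 2 \<le> \<bar>z n - z' n\<bar>" .
  let ?w = "map a [0..<n]"
  have w': "map a' [0..<n] = ?w" using eq by simp
  have "1 / (2 * (real M + 3) ^ 3) / (cf_den ?w 0)\<^sup>2 = (1 / (real M + 3) ^ 3 * 2) / (4 * (cf_den ?w 0)\<^sup>2)"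
    by simp
  also have "\<dots> \<le> \<bar>z n - z' n\<bar> / (4 * (cf_den ?w 0)\<^sup>2)" using step by (intro divide_right_mono) auto
  also have "\<dots> \<le> \<bar>cf_map ?w (z n) - cf_map ?w (z' n)\<bar>"
    using cf_orbitD(1,2)[OF z(1), of n] cf_orbitD(1,2)[OF z(2), of n]
    by (intro abs_cf_map_diff_ge cf_orbit_prefix_pos[OF z(1)]) auto
  also have "\<dots> = \<bar>z 0 - z' 0\<bar>"
    using cf_orbit_eq_cf_map[OF z(1), of n] cf_orbit_eq_cf_map[OF z(2), of n] w' by simp
  finally show ?thesis .
qed

text \<open>The expanding interval map with full branches of lengths \<open>p w\<close>: \<open>d\<close> tells the branch and \<open>f\<close>
  is the map.\<close>

lemma full_branch_map_exists:
  fixes p :: "'a \<Rightarrow> real"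
  assumes "finite B" "\<And>w. w \<in> B \<Longrightarrow> 0 < p w"
  shows "\<exists>d f. (\<forall>u\<in>{0..<sum p B}. d u \<in> B \<and> f u \<in> {0..<1}) \<and>
    (\<forall>u\<in>{0..<sum p B}. \<forall>u'\<in>{0..<sum p B}. d u = d u' \<longrightarrow> u - u' = p (d u) * (f u - f u'))"
  using assms
proof (induction B rule: finite_induct)
  case (insert x B)
  then have "\<exists>d f. (\<forall>u\<in>{0..<sum p B}. d u \<in> B \<and> f u \<in> {0..<1}) \<and>
    (\<forall>u\<in>{0..<sum p B}. \<forall>u'\<in>{0..<sum p B}. d u = d u' \<longrightarrow> u - u' = p (d u) * (f u - f u'))"
    by blast
  then obtain d and f :: "real \<Rightarrow> real" where
    df: "\<And>u. u \<in> {0..<sum p B} \<Longrightarrow> d u \<in> B \<and> f u \<in> {0..<1}"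
    and df': "\<And>u u'. u \<in> {0..<sum p B} \<Longrightarrow> u' \<in> {0..<sum p B} \<Longrightarrow> d u = d u'
      \<Longrightarrow> u - u' = p (d u) * (f u - f u')"
    by blast
  define d' where "d' u = (if u < sum p B then d u else x)" for u
  define f' where "f' u = (if u < sum p B then f u else (u - sum p B) / p x)" for u :: real
  have px: "0 < p x" using insert by simp
  have s: "sum p (insert x B) = p x + sum p B" using insert by simp
  have "d' u \<in> insert x B \<and> f' u \<in> {0..<1}" if "u \<in> {0..<sum p (insert x B)}" for u
    using that df[of u] px unfolding s by (auto simp: d'_def f'_def)
  moreover have "u - u' = p (d' u) * (f' u - f' u')"
    if "u \<in> {0..<sum p (insert x B)}" "u' \<in> {0..<sum p (insert x B)}" "d' u = d' u'" for u u'
  proof (cases "u < sum p B"; cases "u' < sum p B")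
    assume "u < sum p B" "u' < sum p B"
    then show ?thesis using that df'[of u u'] by (simp add: d'_def f'_def)
  next
    assume "u < sum p B" "\<not> u' < sum p B"
    then show ?thesis using that df[of u] insert(2) by (auto simp: d'_def)
  next
    assume "\<not> u < sum p B" "u' < sum p B"
    then show ?thesis using that df[of u'] insert(2) by (auto simp: d'_def)
  next
    assume "\<not> u < sum p B" "\<not> u' < sum p B"
    then show ?thesis using px by (simp add: d'_def f'_def diff_divide_distrib[symmetric])
  qed
  ultimately show ?case by blast
qed auto

subsection \<open>Expansions with prescribed runs\<close>

lemma powr_two_mult_nat: "0 < x \<Longrightarrow> x powr (2 * real n) = x ^ (2 * n)"
  by (metis of_nat_mult of_nat_numeral powr_realpow)

text \<open>The digit sequences are concatenations of words from \<open>B\<close>, where the \<open>k\<close>-th word is preceded by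
  \<open>run k\<close> copies of \<open>i\<close>. A nonempty run has length about \<open>\<nu>\<close> times its starting position; runs are
  inserted so sparsely that all earlier runs together are negligible.\<close>

locale cf_blocks =
  fixes i L :: nat and \<nu> :: real and B :: "nat list set"
  assumes i: "1 \<le> i" and \<nu>: "0 \<le> \<nu>" and L: "1 \<le> L" and finite_B: "finite B"
    and B: "\<And>w. w \<in> B \<Longrightarrow> length w = L" "\<And>w. w \<in> B \<Longrightarrow> 0 \<notin> set w" "\<And>w. w \<in> B \<Longrightarrow> last w \<noteq> i"
begin

primrec run_total :: "nat \<Rightarrow> nat" where
  "run_total 0 = 0"
| "run_total (Suc k) = run_total k +
    (if (1 + \<nu>) * real (run_total k) \<le> real k then nat \<lfloor>\<nu> * (real L * real k + real (run_total k))\<rfloor> else 0)"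

definition run :: "nat \<Rightarrow> nat" where
  "run k = run_total (Suc k) - run_total k"

lemma run_total_Suc: "run_total (Suc k) = run_total k + run k"
  by (simp add: run_def)

lemma run_eq:
  "run k = (if (1 + \<nu>) * real (run_total k) \<le> real k
    then nat \<lfloor>\<nu> * (real L * real k + real (run_total k))\<rfloor> else 0)"
  by (simp add: run_def)

lemma run_le: "real (run k) \<le> \<nu> * (real L * real k + real (run_total k))"
proof -
  have "0 \<le> \<nu> * (real L * real k + real (run_total k))" using \<nu> by simp
  then show ?thesis by (auto simp: run_eq of_nat_nat)
qed

lemma run_total_le: "real (run_total k) \<le> (\<nu> * real L + 1) * real k"
proof (induction k)
  case (Suc k)
  have m: "(\<nu> * real L + 1) * real (Suc k) = (\<nu> * real L + 1) * real k + (\<nu> * real L + 1)"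
    by (simp add: algebra_simps)
  have p: "0 \<le> \<nu> * real L" using \<nu> by simp
  show ?case
  proof (cases "(1 + \<nu>) * real (run_total k) \<le> real k")
    case True
    have "real (run_total (Suc k)) = real (run_total k) + real (run k)" by (simp add: run_total_Suc del: run_total.simps)
    also have "\<dots> \<le> (1 + \<nu>) * real (run_total k) + \<nu> * real L * real k"
      using run_le[of k] by (simp add: algebra_simps)
    also have "\<dots> \<le> real k + \<nu> * real L * real k" using True by simp
    also have "\<dots> = (\<nu> * real L + 1) * real k" by (simp add: algebra_simps)
    finally show ?thesis using m p by linarith
  next
    case False
    then show ?thesis using Suc m p by simp
  qed
qed simp

lemma exists_run_ge:
  "\<exists>k\<ge>k0. \<nu> * (real L * real k + real (run_total k)) - 1 \<le> real (run k)"
proof -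
  have "\<exists>k\<ge>k0. (1 + \<nu>) * real (run_total k) \<le> real k"
  proof (rule ccontr)
    assume "\<not> (\<exists>k\<ge>k0. (1 + \<nu>) * real (run_total k) \<le> real k)"
    then have none: "\<not> (1 + \<nu>) * real (run_total k) \<le> real k" if "k0 \<le> k" for k using that by blast
    have const: "run_total (k0 + j) = run_total k0" for j
    proof (induction j)
      case (Suc j)
      then show ?case using none[of "k0 + j"] by simp
    qed simp
    obtain n where n: "(1 + \<nu>) * real (run_total k0) \<le> real n" using real_arch_simple by blast
    then show False using none[of "k0 + n"] const[of n] by simp
  qed
  then obtain k where k: "k0 \<le> k" "(1 + \<nu>) * real (run_total k) \<le> real k" by blast
  have "\<nu> * (real L * real k + real (run_total k)) - 1 \<le> real (run k)"
    using k(2) by (simp add: run_eq) linarith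
  then show ?thesis using k(1) by blast
qed

context
  fixes W :: "nat \<Rightarrow> nat list"
  assumes W: "\<And>k. W k \<in> B"
begin

primrec blocks :: "nat \<Rightarrow> nat list" where
  "blocks 0 = []"
| "blocks (Suc k) = blocks k @ replicate (run k) i @ W k"

lemma length_blocks: "length (blocks k) = L * k + run_total k"
  by (induction k) (auto simp: run_total_Suc B(1)[OF W] simp del: run_total.simps(2))

lemma zero_notin_blocks: "0 \<notin> set (blocks k)"
  using i by (induction k) (auto simp: B(2)[OF W])

lemma blocks_prefix: "k \<le> m \<Longrightarrow> \<exists>v. blocks m = blocks k @ v"
proof (induction m rule: dec_induct)
  case (step m)
  then show ?case by auto
qed simp

lemma length_blocks_ge: "k \<le> length (blocks k)"
proof -
  have "1 * k \<le> L * k" using L by (intro mult_right_mono) auto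
  then show ?thesis unfolding length_blocks by linarith
qed

definition digit :: "nat \<Rightarrow> nat" where
  "digit n = blocks (Suc n) ! n"

lemma digit_eq:
  assumes "n < length (blocks k)"
  shows "digit n = blocks k ! n"
proof -
  have n: "n < length (blocks (Suc n))" using length_blocks_ge[of "Suc n"] by linarith
  show ?thesis
  proof (cases "k \<le> Suc n")
    case True
    then obtain v where "blocks (Suc n) = blocks k @ v" using blocks_prefix by blast
    then show ?thesis using assms unfolding digit_def by (simp only: nth_append if_True)
  next
    case False
    then obtain v where "blocks k = blocks (Suc n) @ v" using blocks_prefix[of "Suc n" k] by auto
    then show ?thesis using n unfolding digit_def by (simp only: nth_append if_True)
  qed
qed

lemma map_digit_blocks: "map digit [0..<length (blocks k)] = blocks k"
  by (rule nth_equalityI) (auto simp: digit_eq)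

lemma digit_ge_1: "1 \<le> digit n"
proof -
  have n: "n < length (blocks (Suc n))" using length_blocks_ge[of "Suc n"] by linarith
  then have "digit n \<in> set (blocks (Suc n))" unfolding digit_def by (rule nth_mem)
  then have "digit n \<noteq> 0" using zero_notin_blocks[of "Suc n"] by metis
  then show ?thesis by simp
qed

lemma digit_in: "digit n \<in> insert i (\<Union>w\<in>B. set w)"
proof -
  have sub: "set (blocks k) \<subseteq> insert i (\<Union>w\<in>B. set w)" for k
    by (induction k) (use W in auto)
  have n: "n < length (blocks (Suc n))" using length_blocks_ge[of "Suc n"] by linarith
  then have "digit n \<in> set (blocks (Suc n))" unfolding digit_def by (rule nth_mem)
  then show ?thesis using sub by blast
qed

lemma digit_run:
  assumes "j < run k"
  shows "digit (length (blocks k) + j) = i"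
proof -
  have "length (blocks k) + j < length (blocks (Suc k))" using assms by simp
  then have "digit (length (blocks k) + j) = blocks (Suc k) ! (length (blocks k) + j)" by (rule digit_eq)
  then show ?thesis using assms by (simp add: nth_append)
qed

lemma exists_digit_neq: "\<exists>m. real m \<le> \<nu> * real n + real L \<and> digit (n + m) \<noteq> i"
proof -
  define k where "k = (LEAST k. n < length (blocks (Suc k)))"
  have ex: "n < length (blocks (Suc n))" using length_blocks_ge[of "Suc n"] by linarith
  have k: "n < length (blocks (Suc k))" unfolding k_def by (rule LeastI[of _ n]) (rule ex)
  have k': "length (blocks k) \<le> n"
  proof (cases k)
    case (Suc k')
    then have "k' < k" by simp
    then have "\<not> n < length (blocks (Suc k'))" unfolding k_def by (rule not_less_Least)
    then show ?thesis using Suc by simp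
  qed simp
  have ne: "W k \<noteq> []" using B(1)[OF W, of k] L by auto
  define m where "m = length (blocks (Suc k)) - 1 - n"
  have nm: "n + m = length (blocks (Suc k)) - 1" using k by (simp add: m_def)
  have "digit (n + m) = blocks (Suc k) ! (length (blocks (Suc k)) - 1)"
    unfolding nm using k by (intro digit_eq) linarith
  also have "\<dots> = last (blocks (Suc k))" using ne by (subst last_conv_nth) auto
  also have "\<dots> = last (W k)" using ne by simp
  finally have "digit (n + m) \<noteq> i" using B(3)[OF W, of k] by simp
  moreover have "real m \<le> \<nu> * real n + real L"
  proof -
    have "m \<le> run k + L" using k' B(1)[OF W, of k] by (simp add: m_def)
    then have "real m \<le> real (run k) + real L" by linarith
    moreover have "real (run k) \<le> \<nu> * real (length (blocks k))"
      using run_le[of k] by (simp add: length_blocks)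
    moreover have "\<nu> * real (length (blocks k)) \<le> \<nu> * real n" using k' \<nu> by (intro mult_left_mono) auto
    ultimately show ?thesis by linarith
  qed
  ultimately show ?thesis by blast
qed

lemma cf_den_blocks_le:
  "cf_den (blocks k) 0 \<le> (4 * tau i powr (\<nu> * real L + 1)) ^ k * (\<Prod>j<k. cf_den (W j) 0)"
proof -
  have t: "1 < tau i" by (rule tau_gt_1[OF i])
  have Q: "1 \<le> cf_den (W j) 0" for j using cf_den_ge_1[OF B(2)[OF W]] by simp
  have "cf_den (blocks k) 0 \<le> 4 ^ k * tau i ^ run_total k * (\<Prod>j<k. cf_den (W j) 0)"
  proof (induction k)
    case (Suc k)
    have r: "0 \<notin> set (replicate (run k) i)" using i by auto
    have rw: "0 \<notin> set (replicate (run k) i @ W k)" using r B(2)[OF W] by auto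
    have "cf_den (blocks (Suc k)) 0 \<le> 2 * cf_den (blocks k) 0 * cf_den (replicate (run k) i @ W k) 0"
      using cf_den_append_bounds(2)[OF zero_notin_blocks rw] by simp
    also have "\<dots> \<le> 2 * cf_den (blocks k) 0 * (2 * cf_den (replicate (run k) i) 0 * cf_den (W k) 0)"
      using cf_den_append_bounds(2)[OF r B(2)[OF W]] cf_den_ge_1[OF zero_notin_blocks[of k], of 0]
      by (intro mult_left_mono) auto
    also have "\<dots> = 4 * cf_den (blocks k) 0 * cf_den (replicate (run k) i) 0 * cf_den (W k) 0" by simp
    also have "\<dots> \<le> 4 * (4 ^ k * tau i ^ run_total k * (\<Prod>j<k. cf_den (W j) 0)) * tau i ^ run k * cf_den (W k) 0"
    proof (intro mult_right_mono mult_mono order.refl Suc.IH cf_den_replicate_bounds(1)[OF i])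
      show "0 \<le> 4 * (4 ^ k * tau i ^ run_total k * (\<Prod>j<k. cf_den (W j) 0))"
        using t Q by (intro mult_nonneg_nonneg prod_nonneg) (auto intro: order.trans[OF zero_le_one])
      show "0 \<le> cf_den (blocks k) 0" "0 \<le> cf_den (replicate (run k) i) 0" "0 \<le> cf_den (W k) 0"
        using cf_den_ge_1[OF zero_notin_blocks[of k], of 0] cf_den_ge_1[OF r, of 0] Q[of k] by auto
    qed auto
    also have "\<dots> = 4 ^ Suc k * tau i ^ run_total (Suc k) * (\<Prod>j<Suc k. cf_den (W j) 0)"
      by (simp add: run_total_Suc power_add mult_ac del: run_total.simps)
    finally show ?case .
  qed simp
  also have "\<dots> \<le> (4 * tau i powr (\<nu> * real L + 1)) ^ k * (\<Prod>j<k. cf_den (W j) 0)"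
  proof (intro mult_right_mono prod_nonneg)
    have "tau i ^ run_total k = tau i powr real (run_total k)" using t by (simp add: powr_realpow)
    also have "\<dots> \<le> tau i powr ((\<nu> * real L + 1) * real k)"
      using t run_total_le by (intro powr_mono) auto
    also have "\<dots> = (tau i powr (\<nu> * real L + 1)) ^ k"
      using t by (simp add: powr_power mult.commute)
    finally show "4 ^ k * tau i ^ run_total k \<le> (4 * tau i powr (\<nu> * real L + 1)) ^ k"
      by (simp add: power_mult_distrib)
    show "0 \<le> cf_den (W j) 0" for j using Q[of j] by simp
  qed
  finally show ?thesis .
qed

lemma asymp_exponent_digit:
  assumes z: "cf_orbit digit z"
  shows "asymp_exponent (const_cf i) (z 0) = ereal \<nu>"
proof -
  let ?y = "const_cf i" and ?T = "tau i"
  let ?I = "\<lambda>n. measure lborel (basic_interval n ?y)"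
  have T: "1 < ?T" by (rule tau_gt_1[OF i])
  have y: "0 < ?y" "?y < 1" using const_cf_bounds[OF i] by auto
  have yo: "cf_orbit (\<lambda>_. i) (\<lambda>_. ?y)"
    unfolding cf_orbit_def using y inverse_const_cf[OF i] by (auto simp: field_simps)
  have Tn: "(\<lambda>n. K * ?T powr (- c * real n)) \<longlonglongrightarrow> 0" if c: "0 < c" for K c
  proof -
    have "(\<lambda>n. K * (?T powr (- c)) ^ n) \<longlonglongrightarrow> K * 0"
      using T c powr_less_one[of ?T "- c"] by (intro tendsto_intros LIMSEQ_power_zero) auto
    then show ?thesis using T by (simp add: powr_power mult.commute)
  qed
  define S where "S = {ereal v | v. 0 \<le> v \<and> infinite {n. \<bar>(gauss_map ^^ n) (z 0) - ?y\<bar> < ?I n powr v}}"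
  have Ipos: "0 < ?I n" for n
    using measure_basic_interval_bounds(1)[OF i, of n] T by (auto intro: less_le_trans[rotated])
  have zero: "ereal 0 \<in> S"
  proof -
    have "\<bar>(gauss_map ^^ n) (z 0) - ?y\<bar> < ?I n powr 0" for n
      using cf_orbitD(1,2)[OF z, of n] y Ipos[of n] by (simp add: gauss_map_funpow_cf_orbit[OF z] abs_less_iff)
    then show ?thesis by (auto simp: S_def)
  qed
  have low: "ereal v \<in> S" if v: "0 \<le> v" "v < \<nu>" for v
  proof -
    have "\<forall>\<^sub>F n in sequentially. 4 * ?T\<^sup>2 * 2 powr v * ?T powr (- (2 * (\<nu> - v)) * real n) < 1"
      using v by (intro order_tendstoD(2)[OF Tn]) auto
    then obtain n0 where n0: "\<And>n. n0 \<le> n \<Longrightarrow> 4 * ?T\<^sup>2 * 2 powr v * ?T powr (- (2 * (\<nu> - v)) * real n) < 1"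
      by (auto simp: eventually_sequentially)
    have "\<exists>n\<ge>m. \<bar>(gauss_map ^^ n) (z 0) - ?y\<bar> < ?I n powr v" for m
    proof -
      obtain k where k: "max m n0 \<le> k" "\<nu> * (real L * real k + real (run_total k)) - 1 \<le> real (run k)"
        using exists_run_ge by blast
      define n where "n = length (blocks k)"
      have n: "m \<le> n" "n0 \<le> n" using k(1) length_blocks_ge[of k] by (auto simp: n_def)
      have rn: "\<nu> * real n - 1 \<le> real (run k)" using k(2) by (simp add: n_def length_blocks)
      let ?w = "replicate (run k) i"
      have w: "0 \<notin> set ?w" using i by auto
      have zs: "cf_orbit (\<lambda>j. digit (n + j)) (\<lambda>j. z (n + j))" by (rule cf_orbit_shift[OF z])
      have "map (\<lambda>j. digit (n + j)) [0..<run k] = ?w"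
        by (rule nth_equalityI) (auto simp: digit_run n_def)
      then have zn: "z n = cf_map ?w (z (n + run k))"
        using cf_orbit_eq_cf_map[OF zs, of "run k"] by simp
      have "\<bar>z n - ?y\<bar> = \<bar>cf_map ?w (z (n + run k)) - cf_map ?w ?y\<bar>"
        by (simp only: zn cf_map_replicate_const_cf[OF i])
      also have "\<dots> \<le> \<bar>z (n + run k) - ?y\<bar> / (cf_den ?w 0)\<^sup>2"
        using cf_orbitD(1,2)[OF z, of "n + run k"] y by (intro abs_cf_map_diff_le w) auto
      also have "\<dots> \<le> 1 / (cf_den ?w 0)\<^sup>2"
        using cf_orbitD(1,2)[OF z, of "n + run k"] y by (intro divide_right_mono) auto
      also have "\<dots> \<le> 4 / (?T ^ run k)\<^sup>2"
      proof -
        have "(?T ^ run k)\<^sup>2 \<le> (2 * cf_den ?w 0)\<^sup>2"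
          using cf_den_replicate_bounds(2)[OF i, of "run k"] T by (intro power_mono) auto
        moreover have "0 < cf_den ?w 0" using cf_den_ge_1[OF w, of 0] by simp
        ultimately show ?thesis using T by (simp add: divide_simps power_mult_distrib)
      qed
      also have "\<dots> = 4 * ?T powr (- 2 * real (run k))"
        using T powr_two_mult_nat[of ?T "run k"] by (simp add: powr_minus_divide power_mult[symmetric] mult.commute)
      also have "\<dots> \<le> 4 * ?T powr (2 - 2 * \<nu> * real n)"
        using T rn by (intro mult_left_mono powr_mono) auto
      also have "\<dots> = (4 * ?T\<^sup>2 * 2 powr v * ?T powr (- (2 * (\<nu> - v)) * real n)) * (?T powr (- 2 * v * real n) / 2 powr v)"
      proof -
        have "?T powr (2 - 2 * \<nu> * real n) = ?T powr 2 * ?T powr (- (2 * (\<nu> - v)) * real n) * ?T powr (- 2 * v * real n)"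
          by (simp add: powr_add[symmetric] algebra_simps)
        moreover have "?T powr 2 = ?T\<^sup>2" using T by simp
        ultimately show ?thesis by (simp only:) simp
      qed
      also have "\<dots> < 1 * (?T powr (- 2 * v * real n) / 2 powr v)"
        using n0[OF n(2)] T by (intro mult_strict_right_mono) auto
      also have "\<dots> = (1 / (2 * ?T ^ (2 * n))) powr v"
      proof -
        have "?T ^ (2 * n) = ?T powr (2 * real n)" using T by (simp add: powr_two_mult_nat)
        then show ?thesis by (simp add: powr_divide powr_mult powr_powr powr_minus_divide mult_ac)
      qed
      also have "\<dots> \<le> ?I n powr v"
        using v T measure_basic_interval_bounds(1)[OF i, of n] by (intro powr_mono2) auto
      finally show ?thesis using n(1) by (auto simp: gauss_map_funpow_cf_orbit[OF z])
    qed
    then show ?thesis using v unfolding S_def infinite_nat_iff_unbounded_le by auto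
  qed
  have up: "v \<le> \<nu>" if v: "0 \<le> v" "infinite {n. \<bar>(gauss_map ^^ n) (z 0) - ?y\<bar> < ?I n powr v}" for v
  proof (rule ccontr)
    assume "\<not> v \<le> \<nu>"
    then have lt: "\<nu> < v" by simp
    define M where "M = Max (insert i (\<Union>w\<in>B. set w))"
    have fin: "finite (insert i (\<Union>w\<in>B. set w))" using finite_B by auto
    have M: "i \<le> M" "digit n \<le> M" for n
      unfolding M_def using fin digit_in by (auto intro!: Max_ge)
    define c where "c = 1 / (2 * (real M + 3) ^ 3)"
    have c: "0 < c" by (auto simp: c_def)
    have lower: "c * ?T powr (- 2 * real L) * ?T powr (- 2 * \<nu> * real n) \<le> \<bar>z n - ?y\<bar>" for n
    proof -
      obtain m where m: "real m \<le> \<nu> * real n + real L" "digit (n + m) \<noteq> i" using exists_digit_neq by blast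
      define l where "l = (LEAST l. digit (n + l) \<noteq> i)"
      have l: "digit (n + l) \<noteq> i" unfolding l_def by (rule LeastI) (rule m(2))
      have lm: "l \<le> m" unfolding l_def by (rule Least_le) (rule m(2))
      have lt: "digit (n + j) = i" if "j < l" for j using that not_less_Least unfolding l_def by blast
      have "c / (cf_den (map (\<lambda>_. i) [0..<l]) 0)\<^sup>2 \<le> \<bar>?y - z (n + 0)\<bar>"
        unfolding c_def
        by (rule cf_orbit_separation[OF yo cf_orbit_shift[OF z, of n]]) (use M lt l in auto)
      then have a: "c / (cf_den (replicate l i) 0)\<^sup>2 \<le> \<bar>z n - ?y\<bar>"
        by (simp add: map_replicate_const abs_minus_commute)
      have "0 \<notin> set (replicate l i)" using i by auto
      then have Q: "1 \<le> cf_den (replicate l i) 0" using cf_den_ge_1 by simp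
      have "cf_den (replicate l i) 0 \<le> ?T ^ l" by (rule cf_den_replicate_bounds[OF i])
      also have "\<dots> = ?T powr real l" using T by (simp add: powr_realpow)
      also have "\<dots> \<le> ?T powr (\<nu> * real n + real L)" using lm m(1) T by (intro powr_mono) auto
      finally have "(cf_den (replicate l i) 0)\<^sup>2 \<le> (?T powr (\<nu> * real n + real L))\<^sup>2"
        using Q by (intro power_mono) auto
      then have "c / (?T powr (\<nu> * real n + real L))\<^sup>2 \<le> c / (cf_den (replicate l i) 0)\<^sup>2"
        using Q c T by (intro divide_left_mono mult_pos_pos) auto
      moreover have "c / (?T powr (\<nu> * real n + real L))\<^sup>2 = c * ?T powr (- 2 * real L) * ?T powr (- 2 * \<nu> * real n)"
      proof -
        have "(?T powr (\<nu> * real n + real L))\<^sup>2 = ?T powr (2 * (\<nu> * real n + real L))"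
          using T by (simp add: powr_power)
        moreover have "?T powr (- 2 * real L) * ?T powr (- 2 * \<nu> * real n) = 1 / ?T powr (2 * (\<nu> * real n + real L))"
          by (simp add: powr_add[symmetric] powr_minus_divide[symmetric] algebra_simps)
        ultimately show ?thesis by (simp add: mult.assoc)
      qed
      ultimately show ?thesis using a by linarith
    qed
    define K where "K = 4 powr v / (c * ?T powr (- 2 * real L))"
    have K: "0 < K" "K * (c * ?T powr (- 2 * real L)) = 4 powr v" using c T by (auto simp: K_def)
    have "\<forall>\<^sub>F n in sequentially. K * ?T powr (- (2 * (v - \<nu>)) * real n) < 1"
      using lt by (intro order_tendstoD(2)[OF Tn]) auto
    then obtain n0 where n0: "\<And>n. n0 \<le> n \<Longrightarrow> K * ?T powr (- (2 * (v - \<nu>)) * real n) < 1"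
      by (auto simp: eventually_sequentially)
    obtain n where n: "n0 \<le> n" "\<bar>(gauss_map ^^ n) (z 0) - ?y\<bar> < ?I n powr v"
      using v(2) unfolding infinite_nat_iff_unbounded_le by blast
    have "?I n powr v \<le> (4 / ?T ^ (2 * n)) powr v"
      using v measure_basic_interval_bounds(2)[OF i, of n] by (intro powr_mono2) auto
    also have "\<dots> = 4 powr v * ?T powr (- 2 * v * real n)"
    proof -
      have "?T ^ (2 * n) = ?T powr (2 * real n)" using T by (simp add: powr_two_mult_nat)
      then show ?thesis by (simp add: powr_divide powr_powr powr_minus_divide mult_ac)
    qed
    also have "\<dots> = (c * ?T powr (- 2 * real L) * ?T powr (- 2 * \<nu> * real n)) * (K * ?T powr (- (2 * (v - \<nu>)) * real n))"
    proof -
      have e: "?T powr (- 2 * v * real n) = ?T powr (- 2 * \<nu> * real n) * ?T powr (- (2 * (v - \<nu>)) * real n)"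
        by (simp add: powr_add[symmetric] algebra_simps)
      show ?thesis unfolding e K(2)[symmetric] by (simp only: mult_ac)
    qed
    also have "\<dots> \<le> (c * ?T powr (- 2 * real L) * ?T powr (- 2 * \<nu> * real n)) * 1"
      using n0[OF n(1)] c T by (intro mult_left_mono) auto
    also have "\<dots> \<le> \<bar>z n - ?y\<bar>" using lower[of n] by simp
    finally show False using n(2) by (simp add: gauss_map_funpow_cf_orbit[OF z])
  qed
  have "Sup S = ereal \<nu>"
  proof (rule antisym)
    show "Sup S \<le> ereal \<nu>" using up by (intro Sup_least) (auto simp: S_def)
    show "ereal \<nu> \<le> Sup S"
    proof (rule ccontr)
      assume "\<not> ereal \<nu> \<le> Sup S"
      then have "Sup S < ereal \<nu>" by (simp only: not_le)
      then obtain v where v: "Sup S < ereal v" "ereal v < ereal \<nu>" using ereal_dense2 by blast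
      have "ereal 0 \<le> Sup S" using zero by (rule Sup_upper)
      then have "0 \<le> v" using v(1) by (metis ereal_less_eq(3) le_less_trans less_imp_le)
      then have "ereal v \<le> Sup S" using low v(2) by (intro Sup_upper) auto
      then show False using v(1) by simp
    qed
  qed
  then show ?thesis by (simp add: asymp_exponent_def S_def)
qed

end

end

subsection \<open>Lower bound\<close>

context cf_blocks
begin

lemma cf_den_map_digit_le_blocks:
  assumes W: "\<And>k. W k \<in> B" and n: "n < length (blocks W k)"
  shows "cf_den (map (digit W) [0..<n]) 0 \<le> cf_den (blocks W k) 0"
proof -
  have "[0..<length (blocks W k)] = [0..<n] @ [n..<length (blocks W k)]"
    using n upt_add_eq_append[of 0 n "length (blocks W k) - n"] by simp
  then have e: "blocks W k = map (digit W) [0..<n] @ map (digit W) [n..<length (blocks W k)]"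
    by (metis W map_append map_digit_blocks)
  have "0 \<notin> set (map (digit W) ns)" for ns
    using digit_ge_1[of W] W not_one_le_zero by (metis ex_map_conv)
  then show ?thesis by (subst e) (rule cf_den_le_append)
qed

lemma hausdorff_dim_level_set_ge:
  assumes t: "0 < t"
    and big: "(4 * tau i powr (\<nu> * real L + 1)) powr (2 * t) \<le> (\<Sum>w\<in>B. cf_den w 0 powr (-2 * t))"
  shows "ereal t \<le> hausdorff_dim {x \<in> {0..<1}. asymp_exponent (const_cf i) x = ereal \<nu>}"
proof -
  define D where "D = 4 * tau i powr (\<nu> * real L + 1)"
  define \<Theta> where "\<Theta> = (\<Sum>w\<in>B. cf_den w 0 powr (-2 * t))"
  have T: "1 < tau i" by (rule tau_gt_1[OF i])
  have "1 \<le> tau i powr (\<nu> * real L + 1)" using T \<nu> by (intro ge_one_powr_ge_zero) auto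
  then have D: "1 < D" by (simp add: D_def)
  have "1 < D powr (2 * t)" using D t by simp
  then have \<Theta>: "1 < \<Theta>" "D powr (2 * t) \<le> \<Theta>" using big by (auto simp: \<Theta>_def D_def)
  have Q: "1 \<le> cf_den w 0" if "w \<in> B" for w using cf_den_ge_1[OF B(2)[OF that]] by simp
  define p where "p w = cf_den w 0 powr (-2 * t) / \<Theta>" for w
  have p: "0 < p w" "p w \<le> 1 / \<Theta>" if "w \<in> B" for w
  proof -
    show "0 < p w" using Q[OF that] \<Theta> by (simp add: p_def)
    have "cf_den w 0 powr (-2 * t) \<le> cf_den w 0 powr 0" using Q[OF that] t by (intro powr_mono) auto
    then show "p w \<le> 1 / \<Theta>" using \<Theta> Q[OF that] by (simp add: p_def divide_right_mono)
  qed
  have "sum p B = \<Theta> / \<Theta>" unfolding p_def by (simp only: sum_divide_distrib[symmetric] \<Theta>_def)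
  then have sum_p: "sum p B = 1" using \<Theta> by simp
  have "B \<noteq> {}" using sum_p by auto
  define pm where "pm = Min (p ` B)"
  have pm: "0 < pm" "\<And>w. w \<in> B \<Longrightarrow> pm \<le> p w"
    using finite_B \<open>B \<noteq> {}\<close> p(1) by (auto simp: pm_def)
  have "\<exists>d f. (\<forall>u\<in>{0..<sum p B}. d u \<in> B \<and> f u \<in> {0..<1}) \<and>
    (\<forall>u\<in>{0..<sum p B}. \<forall>u'\<in>{0..<sum p B}. d u = d u' \<longrightarrow> u - u' = p (d u) * (f u - f u'))"
    by (rule full_branch_map_exists) (use finite_B p(1) in auto)
  then obtain d and f :: "real \<Rightarrow> real" where
    d: "\<And>u. u \<in> {0..<1} \<Longrightarrow> d u \<in> B" and f: "\<And>u. u \<in> {0..<1} \<Longrightarrow> f u \<in> {0..<1}"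
    and df: "\<And>u u'. u \<in> {0..<1} \<Longrightarrow> u' \<in> {0..<1} \<Longrightarrow> d u = d u' \<Longrightarrow> u - u' = p (d u) * (f u - f u')"
    unfolding sum_p by blast
  have fn: "(f ^^ n) u \<in> {0..<1}" if "u \<in> {0..<1}" for n u
  proof (induction n)
    case (Suc n)
    then show ?case using f[of "(f ^^ n) u"] by simp
  qed (use that in simp)
  define W where "W u n = d ((f ^^ n) u)" for u n
  have W: "W u n \<in> B" if "u \<in> {0..<1}" for u n using d fn that by (simp add: W_def)
  have close: "\<bar>u - u'\<bar> \<le> (\<Prod>j<n. p (W u j))"
    if u: "u \<in> {0..<1}" "u' \<in> {0..<1}" and eq: "\<And>j. j < n \<Longrightarrow> W u j = W u' j" for u u' n
  proof -
    have "u - u' = (\<Prod>j<n. p (W u j)) * ((f ^^ n) u - (f ^^ n) u')"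
      using eq
    proof (induction n)
      case (Suc n)
      have "(f ^^ n) u - (f ^^ n) u' = p (W u n) * ((f ^^ Suc n) u - (f ^^ Suc n) u')"
        using df[OF fn[OF u(1)] fn[OF u(2)], of n n] Suc.prems[of n] by (simp add: W_def)
      moreover have "u - u' = (\<Prod>j<n. p (W u j)) * ((f ^^ n) u - (f ^^ n) u')" using Suc by simp
      ultimately show ?case by simp
    qed simp
    then have "\<bar>u - u'\<bar> = (\<Prod>j<n. p (W u j)) * \<bar>(f ^^ n) u - (f ^^ n) u'\<bar>"
      using p(1)[OF W[OF u(1)]] by (simp add: abs_mult prod_nonneg less_imp_le)
    also have "\<dots> \<le> (\<Prod>j<n. p (W u j)) * 1"
      using fn[OF u(1), of n] fn[OF u(2), of n] p(1)[OF W[OF u(1)]]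
      by (intro mult_left_mono prod_nonneg) (auto simp: abs_le_iff less_imp_le)
    finally show ?thesis by simp
  qed
  have mass: "(\<Prod>j<n. p (W u j)) \<le> cf_den (blocks (W u) n) 0 powr (-2 * t)" if u: "u \<in> {0..<1}" for u n
  proof -
    let ?P = "\<Prod>j<n. cf_den (W u j) 0"
    have P: "1 \<le> ?P" using Q[OF W[OF u]] by (intro prod_ge_1) auto
    have q1: "1 \<le> cf_den (blocks (W u) n) 0" using cf_den_ge_1[OF zero_notin_blocks[OF W[OF u]]] by simp
    have "(\<Prod>j<n. p (W u j)) = (\<Prod>j<n. cf_den (W u j) 0 powr (-2 * t)) / \<Theta> ^ n"
      by (simp add: p_def prod_dividef)
    also have "(\<Prod>j<n. cf_den (W u j) 0 powr (-2 * t)) = ?P powr (-2 * t)"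
      by (rule prod_powr_distrib[symmetric])
    also have "?P powr (-2 * t) / \<Theta> ^ n \<le> ?P powr (-2 * t) / (D powr (2 * t)) ^ n"
      using \<Theta> D by (intro divide_left_mono power_mono mult_pos_pos) auto
    also have "\<dots> = (D ^ n * ?P) powr (-2 * t)"
    proof -
      have "(D powr (2 * t)) ^ n = (D ^ n) powr (2 * t)"
        using D by (simp add: powr_power powr_realpow[symmetric] powr_powr mult_ac)
      then show ?thesis by (simp add: powr_mult powr_minus_divide)
    qed
    also have "\<dots> \<le> cf_den (blocks (W u) n) 0 powr (-2 * t)"
      using cf_den_blocks_le[where W = "W u" and k = n, OF W[OF u]] q1 t by (intro powr_antimono_base) (auto simp: D_def)
    finally show ?thesis .
  qed
  have "\<exists>z. cf_orbit (digit (W u)) z" if "u \<in> {0..<1}" for u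
    by (intro cf_orbit_exists digit_ge_1 W[OF that])
  then have "\<exists>z. \<forall>u. u \<in> {0..<1} \<longrightarrow> cf_orbit (digit (W u)) (z u)" by (intro choice) blast
  then obtain z where z: "\<And>u. u \<in> {0..<1} \<Longrightarrow> cf_orbit (digit (W u)) (z u)" by blast
  define g where "g u = z u 0" for u
  define M where "M = Max (insert i (\<Union>w\<in>B. set w))"
  have M: "digit (W u) n \<le> M" if "u \<in> {0..<1}" for u n
    unfolding M_def using finite_B digit_in[OF W[OF that]] by (intro Max_ge) auto
  define c where "c = 1 / (2 * (real M + 3) ^ 3)"
  have c: "0 < c" by (auto simp: c_def)
  show ?thesis
  proof (rule hausdorff_dim_ge_of_inverse_Hoelder[where g = g and C = "1 / (pm * c powr t)"])
    fix u :: real assume u: "u \<in> {0..<1}"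
    have "asymp_exponent (const_cf i) (g u) = ereal \<nu>"
      unfolding g_def by (rule asymp_exponent_digit[OF W[OF u] z[OF u]])
    then show "g u \<in> {x \<in> {0..<1}. asymp_exponent (const_cf i) x = ereal \<nu>} \<inter> {0..1}"
      using cf_orbitD(1,2)[OF z[OF u], of 0] by (auto simp: g_def)
  next
    fix u u' :: real assume u: "u \<in> {0..<1}" "u' \<in> {0..<1}"
    show "\<bar>u - u'\<bar> \<le> 1 / (pm * c powr t) * \<bar>g u - g u'\<bar> powr t"
    proof (cases "u = u'")
      case True
      then show ?thesis by simp
    next
      case False
      have "\<exists>k. W u k \<noteq> W u' k"
      proof (rule ccontr)
        assume "\<not> (\<exists>k. W u k \<noteq> W u' k)"
        then have eq: "\<And>j. W u j = W u' j" by blast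
        have le: "\<bar>u - u'\<bar> \<le> (1 / \<Theta>) ^ n" for n
        proof -
          have "\<bar>u - u'\<bar> \<le> (\<Prod>j<n. p (W u j))" by (rule close[OF u eq])
          also have "\<dots> \<le> (\<Prod>j<n. 1 / \<Theta>)" using p W[OF u(1)] by (intro prod_mono) (auto simp: less_imp_le)
          finally show ?thesis by simp
        qed
        have "(\<lambda>n. (1 / \<Theta>) ^ n) \<longlonglongrightarrow> 0" using \<Theta> by (intro LIMSEQ_power_zero) auto
        then have "\<bar>u - u'\<bar> \<le> 0" by (rule LIMSEQ_le_const) (use le in blast)
        then show False using False by simp
      qed
      then obtain k0 where k0: "W u k0 \<noteq> W u' k0" by blast
      define k where "k = (LEAST k. W u k \<noteq> W u' k)"
      have k: "W u k \<noteq> W u' k" unfolding k_def by (rule LeastI) (rule k0)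
      have kl: "W u j = W u' j" if "j < k" for j using that not_less_Least unfolding k_def by blast
      let ?V = "blocks (W u) (Suc k)" and ?V' = "blocks (W u') (Suc k)"
      have len: "length ?V = length ?V'" by (simp only: length_blocks[OF W[OF u(1)]] length_blocks[OF W[OF u(2)]])
      have "drop (length (blocks (W x) (Suc k)) - L) (blocks (W x) (Suc k)) = W x k" if "x \<in> {0..<1}" for x
        using B(1)[OF W[OF that, of k]] by (simp add: blocks.simps(2)[where W = "W x", OF W[OF that]])
      from this[OF u(1)] this[OF u(2)] have "?V \<noteq> ?V'" using k by metis
      then obtain m where m: "m < length ?V" "?V ! m \<noteq> ?V' ! m" using len nth_equalityI by blast
      then have ne: "digit (W u) m \<noteq> digit (W u') m"
        using digit_eq[where W = "W u" and n = m and k = "Suc k", OF W[OF u(1)]] digit_eq[where W = "W u'" and n = m and k = "Suc k", OF W[OF u(2)]] len by simp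
      define n where "n = (LEAST n. digit (W u) n \<noteq> digit (W u') n)"
      have n: "digit (W u) n \<noteq> digit (W u') n" unfolding n_def by (rule LeastI) (rule ne)
      have nm: "n \<le> m" unfolding n_def by (rule Least_le) (rule ne)
      have nl: "digit (W u) j = digit (W u') j" if "j < n" for j using that not_less_Least unfolding n_def by blast
      let ?q = "cf_den ?V 0"
      have q: "1 \<le> ?q" using cf_den_ge_1[OF zero_notin_blocks[OF W[OF u(1)]]] by simp
      have q': "1 \<le> cf_den (map (digit (W u)) [0..<n]) 0"
        using cf_den_ge_1[OF cf_orbit_prefix_pos[OF z[OF u(1)]]] by simp
      have "cf_den (map (digit (W u)) [0..<n]) 0 \<le> ?q"
        using m(1) nm by (intro cf_den_map_digit_le_blocks W[OF u(1)]) auto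
      then have "c / ?q\<^sup>2 \<le> c / (cf_den (map (digit (W u)) [0..<n]) 0)\<^sup>2"
        using c q q' by (intro divide_left_mono power_mono mult_pos_pos) auto
      also have "\<dots> \<le> \<bar>g u - g u'\<bar>"
        unfolding c_def g_def using M u nl n by (intro cf_orbit_separation[OF z z]) auto
      finally have sep: "c / ?q\<^sup>2 \<le> \<bar>g u - g u'\<bar>" .
      have "pm * \<bar>u - u'\<bar> \<le> p (W u k) * (\<Prod>j<k. p (W u j))"
        using pm p(1) W[OF u(1)] close[OF u kl] by (intro mult_mono) (auto simp: less_imp_le)
      also have "\<dots> = (\<Prod>j<Suc k. p (W u j))" by simp
      also have "\<dots> \<le> ?q powr (-2 * t)" by (rule mass[OF u(1)])
      also have "\<dots> = (c / ?q\<^sup>2) powr t / c powr t"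
      proof -
        have "?q\<^sup>2 powr t = ?q powr (2 * t)"
        proof -
          have "?q\<^sup>2 = ?q powr 2" using q by simp
          then show ?thesis by (simp only: powr_powr)
        qed
        then show ?thesis using c by (simp add: powr_divide powr_minus_divide)
      qed
      also have "\<dots> \<le> \<bar>g u - g u'\<bar> powr t / c powr t"
        using sep c q t by (intro divide_right_mono powr_mono2) auto
      finally show ?thesis using pm(1) c by (simp add: field_simps)
    qed
  qed (use pm c t in auto)
qed

end

lemma hausdorff_dim_level_set_ge_of_unbounded:
  assumes i: "1 \<le> i" and \<nu>: "0 \<le> \<nu>" and t: "0 < t"
    and unb: "\<And>K. \<exists>n. ennreal K < cf_sum (tau i powr \<nu>) t n"
  shows "ereal t \<le> hausdorff_dim {x \<in> {0..<1}. asymp_exponent (const_cf i) x = ereal \<nu>}"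
proof -
  define e where "e = Suc i"
  define b where "b = tau i powr \<nu>"
  have T: "1 < tau i" by (rule tau_gt_1[OF i])
  have b: "1 \<le> b" using T \<nu> by (simp add: b_def ge_one_powr_ge_zero)
  define K where "K = (2 * real e * (4 * tau i powr (\<nu> + 1))) powr (2 * t)"
  obtain N where "ennreal K < cf_sum b t N" using unb b_def by blast
  also have "cf_sum b t N = infsum (\<lambda>w. ennreal (cf_weight b w powr (-2 * t))) (cf_words N)"
    unfolding cf_sum_def by (rule infsum_eq_nn_integral_count_space[symmetric]) simp
  also have "\<dots> = (SUP F\<in>{F. finite F \<and> F \<subseteq> cf_words N}. \<Sum>w\<in>F. ennreal (cf_weight b w powr (-2 * t)))"
    by (rule nonneg_infsum_complete) simp
  finally obtain F where F: "finite F" "F \<subseteq> cf_words N"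
    "ennreal K < (\<Sum>w\<in>F. ennreal (cf_weight b w powr (-2 * t)))"
    unfolding less_SUP_iff by blast
  have FK: "K \<le> (\<Sum>w\<in>F. cf_weight b w powr (-2 * t))"
    using F(3) by (simp add: sum_ennreal ennreal_less_iff K_def)
  define B where "B = (\<lambda>w. w @ [e]) ` F"
  have Bl: "length w = Suc N \<and> 0 \<notin> set w \<and> last w \<noteq> i" if "w \<in> B" for w
    using that F(2) by (auto simp: B_def cf_words_def e_def)
  interpret cf_blocks i "Suc N" \<nu> B
    by unfold_locales (use i \<nu> F(1) Bl in \<open>auto simp: B_def\<close>)
  show ?thesis
  proof (rule hausdorff_dim_level_set_ge[OF t])
    let ?E = "2 * real e"
    have E: "0 < ?E" by (simp add: e_def)
    have le: "(?E powr (-2 * t) * (b ^ N) powr (2 * t)) * cf_weight b w powr (-2 * t) \<le> cf_den (w @ [e]) 0 powr (-2 * t)"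
      if "w \<in> F" for w
    proof -
      have w: "0 \<notin> set w" "length w = N" using that F(2) by (auto simp: cf_words_def)
      have e: "0 \<notin> set [e]" "cf_den [e] 0 = real e" "1 \<le> cf_den (w @ [e]) 0"
        using cf_den_ge_1[of "w @ [e]" 0] w by (auto simp: e_def)
      have Q: "1 \<le> cf_den w 0" using cf_den_ge_1[OF w(1)] by simp
      have "cf_den (w @ [e]) 0 \<le> ?E * cf_den w 0"
        using cf_den_append_bounds(2)[OF w(1) e(1)] e(2) by (simp add: mult_ac)
      then have "(?E * cf_den w 0) powr (-2 * t) \<le> cf_den (w @ [e]) 0 powr (-2 * t)"
        using e(3) t by (intro powr_antimono_base) auto
      moreover have "(?E * cf_den w 0) powr (-2 * t)
          = (?E powr (-2 * t) * (b ^ N) powr (2 * t)) * cf_weight b w powr (-2 * t)"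
        using b by (simp only: cf_weight_def w(2) powr_mult) (simp add: powr_minus_divide)
      ultimately show ?thesis by simp
    qed
    have "(4 * tau i powr (\<nu> * real (Suc N) + 1)) powr (2 * t)
        = (?E powr (-2 * t) * (b ^ N) powr (2 * t)) * K"
    proof -
      have "tau i powr (\<nu> * real (Suc N) + 1) = b ^ N * tau i powr (\<nu> + 1)"
      proof -
        have "b ^ N = tau i powr (\<nu> * real N)" using T by (simp add: b_def powr_power mult.commute)
        then show ?thesis by (simp add: powr_add[symmetric] algebra_simps)
      qed
      then have "(4 * tau i powr (\<nu> * real (Suc N) + 1)) powr (2 * t)
          = (b ^ N * (4 * tau i powr (\<nu> + 1))) powr (2 * t)" by (simp only: mult_ac)
      also have "\<dots> = (b ^ N) powr (2 * t) * (4 * tau i powr (\<nu> + 1)) powr (2 * t)" by (rule powr_mult)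
      also have "K = ?E powr (2 * t) * (4 * tau i powr (\<nu> + 1)) powr (2 * t)" unfolding K_def by (rule powr_mult)
      then have "(4 * tau i powr (\<nu> + 1)) powr (2 * t) = ?E powr (-2 * t) * K"
        using E by (simp add: powr_minus_divide)
      finally show ?thesis by (simp only: mult_ac)
    qed
    also have "\<dots> \<le> (?E powr (-2 * t) * (b ^ N) powr (2 * t)) * (\<Sum>w\<in>F. cf_weight b w powr (-2 * t))"
      using FK by (intro mult_left_mono) auto
    also have "\<dots> \<le> (\<Sum>w\<in>F. cf_den (w @ [e]) 0 powr (-2 * t))"
      unfolding sum_distrib_left by (intro sum_mono le)
    also have "\<dots> = (\<Sum>w\<in>B. cf_den w 0 powr (-2 * t))"
      unfolding B_def by (subst sum.reindex) (auto simp: inj_on_def)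
    finally show "(4 * tau i powr (\<nu> * real (Suc N) + 1)) powr (2 * t) \<le> (\<Sum>w\<in>B. cf_den w 0 powr (-2 * t))" .
  qed
qed

theorem corollary1p4:
  fixes i :: nat and y \<nu> :: real
  assumes "i \<ge> 1"
    and "y = (sqrt ((real i)\<^sup>2 + 4) - real i) / 2"
    and "\<nu> \<ge> 0"
  shows "hausdorff_dim {x \<in> {0..<1}. asymp_exponent y x = ereal \<nu>} =
         ereal (dim_number (\<nu> / (1 + \<nu>)) (tau i))"
proof -
  define E where "E = {x \<in> {0..<1}. asymp_exponent (const_cf i) x = ereal \<nu>}"
  define s where "s = dim_number (\<nu> / (1 + \<nu>)) (tau i)"
  have y: "y = const_cf i" by (simp add: assms(2) const_cf_def)
  have T: "1 < tau i" by (rule tau_gt_1[OF assms(1)])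
  have "hausdorff_dim E \<le> ereal s"
  proof (cases "\<nu> = 0")
    case True
    then have "s = 1" by (simp add: s_def dim_number_def)
    moreover have "E \<subseteq> {0..1}" by (auto simp: E_def)
    ultimately show ?thesis using hausdorff_dim_le_one[of E] by (simp add: one_ereal_def)
  next
    case False
    then have \<nu>: "0 < \<nu>" using assms(3) by simp
    have s: "s = cf_crit (tau i powr \<nu>)" unfolding s_def by (rule dim_number_eq_cf_crit[OF \<nu> T])
    have "1 < tau i powr \<nu>" using T \<nu> by simp
    then have "0 \<le> s" unfolding s by (rule cf_crit_nonneg)
    have *: "hausdorff_dim E \<le> ereal \<rho>" if "s < \<rho>" for \<rho>
      unfolding E_def using that \<open>0 \<le> s\<close>
      by (intro hausdorff_dim_le hausdorff_measure_level_set_eq_0[OF assms(1) \<nu>]) (auto simp: s)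
    show ?thesis
    proof (rule dense_ge)
      fix x assume "ereal s < x"
      then show "hausdorff_dim E \<le> x" using * by (cases x) auto
    qed
  qed
  moreover have "ereal s \<le> hausdorff_dim E"
  proof (rule dense_le)
    fix x assume x: "x < ereal s"
    have unb: "\<exists>n. ennreal K < cf_sum (tau i powr \<nu>) t n" if t: "0 < t" "t < s" for t K
    proof (cases "\<nu> = 0")
      case True
      then show ?thesis using t T cf_sum_one_base_unbounded[of t K] by (simp add: s_def dim_number_def)
    next
      case False
      then have \<nu>: "0 < \<nu>" using assms(3) by simp
      have "1 < tau i powr \<nu>" using T \<nu> by simp
      then show ?thesis using t dim_number_eq_cf_crit[OF \<nu> T]
        by (intro cf_sum_unbounded_below_crit) (auto simp: s_def)
    qed
    show "x \<le> hausdorff_dim E"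
    proof (cases "0 < x")
      case True
      then obtain t where "x = ereal t" "0 < t" "t < s" using x by (cases x) auto
      then show ?thesis
        unfolding E_def using hausdorff_dim_level_set_ge_of_unbounded[OF assms(1,3) _ unb] by simp
    next
      case False
      then show ?thesis using hausdorff_dim_nonneg[of E] by (simp add: not_less)
    qed
  qed
  ultimately show ?thesis unfolding E_def s_def y by (rule antisym)
qed

end
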